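(* Let $\mathscr{A}$ be an abelian arrangement of rank $r$ in $T\cong G^\ell$. Then $L(\mathscr{A})$ is supersolvable (resp. strictly supersolvable) if and only if there is a chain $\varnothing=\mathscr{A}_0\subseteq\mathscr{A}_1\subseteq\cdots\subseteq\mathscr{A}_r=\mathscr{A}$ of subarrangements such that each $\mathscr{A}_i$ is an M-ideal (resp. a TM-ideal) of $\mathscr{A}_{i+1}$ in the arrangement sense.
   Context: Setting: $G\cong(\mathbb{S}^1)^a\times\mathbb{R}^b$, $g=a+b$, $\Gamma\cong\mathbb{Z}^\ell$, $T=\operatorname{Hom}(\Gamma,G)$, $H_{\alpha,c}=\{\varphi\in T:\varphi(\alpha)=c\}$; an abelian arrangement is the set of connected components of $H_{\alpha,c}$ for $(\alpha,c)$ in a finite subset of $(\Gamma\setminus\{0\})\times G$. $L(\mathscr{A})$: connected components of nonempty intersections of subsets of $\mathscr{A}$ (empty intersection $=T$), ordered by reverse inclusion, rank $\operatorname{codim}/g$; the rank of $\mathscr{A}$ is the maximal rank in $L(\mathscr{A})$. For a subarrangement $\mathscr{B}\subseteq\mathscr{A}$, $L(\mathscr{B})\subseteq L(\mathscr{A})$. Arrangement sense: $\mathscr{B}$ is an M-ideal of $\mathscr{A}$ if $L(\mathscr{B})$ is a proper order ideal of $L(\mathscr{A})$ and for any two distinct $H_1,H_2\in\mathscr{A}\setminus\mathscr{B}$ and every connected component $C$ of $H_1\cap H_2$ there is $H_3\in\mathscr{B}$ with $C\subseteq H_3$; it is a TM-ideal if moreover $X\cap H$ is connected for every $X\in L(\mathscr{B})$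 and $H\in\mathscr{A}\setminus\mathscr{B}$. Poset sense: posets are finite, with minimum $\hat0$, ranked; $\bigvee T$ is the set of minimal upper bounds; a lattice is geometric if $y$ covers $x$ iff $y=x\vee a$ for an atom $a\not\le x$; locally geometric means every $\mathcal{P}_{\le x}$ is a geometric lattice; $x$ in a geometric lattice $L$ is modular if $x\wedge(y\vee z)=(x\wedge y)\vee z$ for all $z\le x$, $y\in L$. An M-ideal of a locally geometric $\mathcal{P}$ is a pure (all maximal elements of equal rank), join-closed ($T\subseteq\mathcal{Q}\Rightarrow\bigvee T\subseteq\mathcal{Q}$) order ideal $\mathcal{Q}$ with (1) $|a\vee y|\ge1$ for $y\in\mathcal{Q}$, $a\in A(\mathcal{P})\setminus A(\mathcal{Q})$ ($A$ = set of atoms) and (2) for each maximal $x\in\mathcal{P}$ some maximal $y\in\mathcal{Q}$ is modular in $\mathcal{P}_{\le x}$; a TM-ideal replaces (1) by $|a\vee y|=1$. $\mathcal{P}$ is supersolvable (resp. strictly supersolvable) if there is a chain $\{\hat0\}=\mathcal{Q}_0\subsetneq\cdots\subsetneq\mathcal{Q}_r=\mathcal{P}$ with each $\mathcal{Q}_i$ an M-ideal (resp. TM-ideal) of $\mathcal{Q}_{i+1}$ and $\operatorname{rk}(\mathcal{Q}_i)=i$. *)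

theory Defs
  imports "HOL-Analysis.Analysis"
begin

definition is_min :: "'x set \<Rightarrow> ('x \<Rightarrow> 'x \<Rightarrow> bool) \<Rightarrow> 'x \<Rightarrow> bool" where
  "is_min P le z \<equiv> z \<in> P \<and> (\<forall>x\<in>P. le z x)"

definition below :: "'x set \<Rightarrow> ('x \<Rightarrow> 'x \<Rightarrow> bool) \<Rightarrow> 'x \<Rightarrow> 'x set" where
  "below P le x = {y \<in> P. le y x}"

definition covers :: "'x set \<Rightarrow> ('x \<Rightarrow> 'x \<Rightarrow> bool) \<Rightarrow> 'x \<Rightarrow> 'x \<Rightarrow> bool" where
  "covers P le x y \<equiv> x \<in> P \<and> y \<in> P \<and> le x y \<and> x \<noteq> y \<and>
     \<not> (\<exists>z\<in>P. le x z \<and> le z y \<and> z \<noteq> x \<and> z \<noteq> y)"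

definition atoms :: "'x set \<Rightarrow> ('x \<Rightarrow> 'x \<Rightarrow> bool) \<Rightarrow> 'x set" where
  "atoms P le = {a \<in> P. \<exists>z. is_min P le z \<and> covers P le z a}"

definition ubs :: "'x set \<Rightarrow> ('x \<Rightarrow> 'x \<Rightarrow> bool) \<Rightarrow> 'x set \<Rightarrow> 'x set" where
  "ubs P le S = {z \<in> P. \<forall>s\<in>S. le s z}"

definition lbs :: "'x set \<Rightarrow> ('x \<Rightarrow> 'x \<Rightarrow> bool) \<Rightarrow> 'x set \<Rightarrow> 'x set" where
  "lbs P le S = {z \<in> P. \<forall>s\<in>S. le z s}"

definition mubs :: "'x set \<Rightarrow> ('x \<Rightarrow> 'x \<Rightarrow> bool) \<Rightarrow> 'x set \<Rightarrow> 'x set" where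
  "mubs P le S = {z \<in> ubs P le S. \<forall>w\<in>ubs P le S. le w z \<longrightarrow> w = z}"

definition partial_order_on' :: "'x set \<Rightarrow> ('x \<Rightarrow> 'x \<Rightarrow> bool) \<Rightarrow> bool" where
  "partial_order_on' P le \<equiv> (\<forall>x\<in>P. le x x) \<and>
     (\<forall>x\<in>P. \<forall>y\<in>P. le x y \<and> le y x \<longrightarrow> x = y) \<and>
     (\<forall>x\<in>P. \<forall>y\<in>P. \<forall>z\<in>P. le x y \<and> le y z \<longrightarrow> le x z)"

definition is_lattice :: "'x set \<Rightarrow> ('x \<Rightarrow> 'x \<Rightarrow> bool) \<Rightarrow> bool" where
  "is_lattice P le \<equiv> \<forall>x\<in>P. \<forall>y\<in>P.
     (\<exists>z\<in>ubs P le {x, y}. \<forall>w\<in>ubs P le {x, y}. le z w) \<and>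
     (\<exists>z\<in>lbs P le {x, y}. \<forall>w\<in>lbs P le {x, y}. le w z)"

definition join :: "'x set \<Rightarrow> ('x \<Rightarrow> 'x \<Rightarrow> bool) \<Rightarrow> 'x \<Rightarrow> 'x \<Rightarrow> 'x" where
  "join P le x y = (THE z. z \<in> ubs P le {x, y} \<and> (\<forall>w\<in>ubs P le {x, y}. le z w))"

definition meet :: "'x set \<Rightarrow> ('x \<Rightarrow> 'x \<Rightarrow> bool) \<Rightarrow> 'x \<Rightarrow> 'x \<Rightarrow> 'x" where
  "meet P le x y = (THE z. z \<in> lbs P le {x, y} \<and> (\<forall>w\<in>lbs P le {x, y}. le w z))"

definition geometric_lattice :: "'x set \<Rightarrow> ('x \<Rightarrow> 'x \<Rightarrow> bool) \<Rightarrow> bool" where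
  "geometric_lattice L le \<equiv> is_lattice L le \<and>
     (\<forall>x\<in>L. \<forall>y\<in>L. covers L le x y \<longleftrightarrow>
        (\<exists>a\<in>atoms L le. \<not> le a x \<and> y = join L le x a))"

definition ranked :: "'x set \<Rightarrow> ('x \<Rightarrow> 'x \<Rightarrow> bool) \<Rightarrow> bool" where
  "ranked P le \<equiv> \<exists>\<rho> :: 'x \<Rightarrow> nat. (\<forall>z. is_min P le z \<longrightarrow> \<rho> z = 0) \<and>
     (\<forall>x y. covers P le x y \<longrightarrow> \<rho> y = Suc (\<rho> x))"

definition good_poset :: "'x set \<Rightarrow> ('x \<Rightarrow> 'x \<Rightarrow> bool) \<Rightarrow> bool" where
  "good_poset P le \<equiv> finite P \<and> partial_order_on' P le \<and> (\<exists>z. is_min P le z) \<and> ranked P le"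

definition locally_geometric :: "'x set \<Rightarrow> ('x \<Rightarrow> 'x \<Rightarrow> bool) \<Rightarrow> bool" where
  "locally_geometric P le \<equiv> good_poset P le \<and> (\<forall>x\<in>P. geometric_lattice (below P le x) le)"

definition is_chain :: "'x set \<Rightarrow> ('x \<Rightarrow> 'x \<Rightarrow> bool) \<Rightarrow> 'x set \<Rightarrow> bool" where
  "is_chain P le c \<equiv> c \<subseteq> P \<and> (\<forall>x\<in>c. \<forall>y\<in>c. le x y \<or> le y x)"

definition prk :: "'x set \<Rightarrow> ('x \<Rightarrow> 'x \<Rightarrow> bool) \<Rightarrow> 'x \<Rightarrow> nat" where
  "prk P le x = Max {card c - 1 | c. is_chain (below P le x) le c \<and> c \<noteq> {}}"

definition poset_rank :: "'x set \<Rightarrow> ('x \<Rightarrow> 'x \<Rightarrow> bool) \<Rightarrow> nat" where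
  "poset_rank P le = Max (prk P le ` P)"

definition maximals :: "'x set \<Rightarrow> ('x \<Rightarrow> 'x \<Rightarrow> bool) \<Rightarrow> 'x set" where
  "maximals P le = {x \<in> P. \<forall>y\<in>P. le x y \<longrightarrow> y = x}"

definition order_ideal :: "'x set \<Rightarrow> ('x \<Rightarrow> 'x \<Rightarrow> bool) \<Rightarrow> 'x set \<Rightarrow> bool" where
  "order_ideal P le Q \<equiv> Q \<subseteq> P \<and> (\<forall>x\<in>Q. \<forall>y\<in>P. le y x \<longrightarrow> y \<in> Q)"

definition modular_elem :: "'x set \<Rightarrow> ('x \<Rightarrow> 'x \<Rightarrow> bool) \<Rightarrow> 'x \<Rightarrow> bool" where
  "modular_elem L le x \<equiv> x \<in> L \<and> (\<forall>y\<in>L. \<forall>z\<in>L. le z x \<longrightarrow>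
      meet L le x (join L le y z) = join L le (meet L le x y) z)"

definition pure :: "'x set \<Rightarrow> ('x \<Rightarrow> 'x \<Rightarrow> bool) \<Rightarrow> bool" where
  "pure Q le \<equiv> \<forall>x\<in>maximals Q le. \<forall>y\<in>maximals Q le. prk Q le x = prk Q le y"

definition join_closed :: "'x set \<Rightarrow> ('x \<Rightarrow> 'x \<Rightarrow> bool) \<Rightarrow> 'x set \<Rightarrow> bool" where
  "join_closed P le Q \<equiv> \<forall>S. S \<subseteq> Q \<longrightarrow> mubs P le S \<subseteq> Q"

definition modular_cond :: "'x set \<Rightarrow> ('x \<Rightarrow> 'x \<Rightarrow> bool) \<Rightarrow> 'x set \<Rightarrow> bool" where
  "modular_cond P le Q \<equiv> \<forall>x\<in>maximals P le. \<exists>y\<in>maximals Q le.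
      le y x \<and> modular_elem (below P le x) le y"

definition M_ideal :: "'x set \<Rightarrow> ('x \<Rightarrow> 'x \<Rightarrow> bool) \<Rightarrow> 'x set \<Rightarrow> bool" where
  "M_ideal P le Q \<equiv> locally_geometric P le \<and> order_ideal P le Q \<and> pure Q le \<and>
     join_closed P le Q \<and>
     (\<forall>y\<in>Q. \<forall>a\<in>atoms P le - atoms Q le. card (mubs P le {a, y}) \<ge> 1) \<and>
     modular_cond P le Q"

definition TM_ideal :: "'x set \<Rightarrow> ('x \<Rightarrow> 'x \<Rightarrow> bool) \<Rightarrow> 'x set \<Rightarrow> bool" where
  "TM_ideal P le Q \<equiv> locally_geometric P le \<and> order_ideal P le Q \<and> pure Q le \<and>
     join_closed P le Q \<and>
     (\<forall>y\<in>Q. \<forall>a\<in>atoms P le - atoms Q le. card (mubs P le {a, y}) = 1) \<and>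
     modular_cond P le Q"

definition supersolvable :: "'x set \<Rightarrow> ('x \<Rightarrow> 'x \<Rightarrow> bool) \<Rightarrow> bool" where
  "supersolvable P le \<equiv> locally_geometric P le \<and>
     (\<exists>(r::nat) (Qs :: nat \<Rightarrow> 'x set). Qs 0 = {z. is_min P le z} \<and> Qs r = P \<and>
        (\<forall>i<r. Qs i \<subset> Qs (Suc i) \<and> M_ideal (Qs (Suc i)) le (Qs i)) \<and>
        (\<forall>i\<le>r. poset_rank (Qs i) le = i))"

definition strictly_supersolvable :: "'x set \<Rightarrow> ('x \<Rightarrow> 'x \<Rightarrow> bool) \<Rightarrow> bool" where
  "strictly_supersolvable P le \<equiv> locally_geometric P le \<and>
     (\<exists>(r::nat) (Qs :: nat \<Rightarrow> 'x set). Qs 0 = {z. is_min P le z} \<and> Qs r = P \<and>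
        (\<forall>i<r. Qs i \<subset> Qs (Suc i) \<and> TM_ideal (Qs (Suc i)) le (Qs i)) \<and>
        (\<forall>i\<le>r. poset_rank (Qs i) le = i))"

text \<open>G = (S^1)^a \<times> R^b is modelled inside complex^'g: coordinates in C are unit complex
  numbers (circle factors, multiplicative), the others are real numbers (additive).
  Gamma = Z^l is int^'l, and T = Hom(Gamma, G) is identified with G^l = (complex^'g)^'l
  via phi \<mapsto> (phi(e_i))_i.\<close>

definition Gset :: "'g set \<Rightarrow> (complex^'g) set" where
  "Gset C = {z. \<forall>j. (j \<in> C \<longrightarrow> norm (z$j) = 1) \<and> (j \<notin> C \<longrightarrow> Im (z$j) = 0)}"

definition Tset :: "'g set \<Rightarrow> (complex^'g^'l) set" where
  "Tset C = {\<phi>. \<forall>i. \<phi>$i \<in> Gset C}"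

definition ev :: "'g set \<Rightarrow> complex^'g^'l \<Rightarrow> int^'l \<Rightarrow> complex^'g" where
  "ev C \<phi> \<alpha> = (\<chi> j. if j \<in> C then (\<Prod>i\<in>UNIV. (\<phi>$i$j) powi (\<alpha>$i))
                    else (\<Sum>i\<in>UNIV. of_int (\<alpha>$i) * \<phi>$i$j))"

definition Hyp :: "'g set \<Rightarrow> int^'l \<Rightarrow> complex^'g \<Rightarrow> (complex^'g^'l) set" where
  "Hyp C \<alpha> c = {\<phi> \<in> Tset C. ev C \<phi> \<alpha> = c}"

definition abelian_arrangement :: "'g set \<Rightarrow> (complex^'g^'l) set set \<Rightarrow> bool" where
  "abelian_arrangement C A \<equiv> \<exists>S :: ((int^'l) \<times> (complex^'g)) set. finite S \<and>
     (\<forall>(\<alpha>, c)\<in>S. \<alpha> \<noteq> 0 \<and> c \<in> Gset C) \<and>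
     A = (\<Union>(\<alpha>, c)\<in>S. components (Hyp C \<alpha> c))"

text \<open>The intersection poset L(A) (ordered by reverse inclusion); empty intersection = T.\<close>
definition Lpos :: "'g set \<Rightarrow> (complex^'g^'l) set set \<Rightarrow> (complex^'g^'l) set set" where
  "Lpos C A = {X. \<exists>B. B \<subseteq> A \<and> Tset C \<inter> \<Inter>B \<noteq> {} \<and> X \<in> components (Tset C \<inter> \<Inter>B)}"

definition revincl :: "'y set \<Rightarrow> 'y set \<Rightarrow> bool" where
  "revincl X Y \<equiv> Y \<subseteq> X"

text \<open>Dimension of a layer via the universal covering R^(l*g) \<rightarrow> T: the affine dimension
  of a connected component of its preimage.\<close>
definition cover :: "'g set \<Rightarrow> real^'g^'l \<Rightarrow> complex^'g^'l" where
  "cover C \<theta> = (\<chi> i j. if j \<in> C then cis (2 * pi * \<theta>$i$j) else complex_of_real (\<theta>$i$j))"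

definition dimT :: "'g set \<Rightarrow> (complex^'g^'l) set \<Rightarrow> int" where
  "dimT C X = aff_dim (connected_component_set (cover C -` X) (SOME \<theta>. cover C \<theta> \<in> X))"

definition codimT :: "'g set \<Rightarrow> (complex^'g^'l) set \<Rightarrow> int" where
  "codimT C X = int (CARD('l) * CARD('g)) - dimT C X"

definition rankT :: "'g set \<Rightarrow> (complex^'g^'l) set \<Rightarrow> nat" where
  "rankT C X = nat (codimT C X div int CARD('g))"

definition arr_rank :: "'g set \<Rightarrow> (complex^'g^'l) set set \<Rightarrow> nat" where
  "arr_rank C A = Max (rankT C ` Lpos C A)"

definition arr_M_ideal :: "'g set \<Rightarrow> (complex^'g^'l) set set \<Rightarrow> (complex^'g^'l) set set \<Rightarrow> bool" where
  "arr_M_ideal C A B \<equiv> B \<subseteq> A \<and> order_ideal (Lpos C A) revincl (Lpos C B) \<and>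
     Lpos C B \<noteq> Lpos C A \<and>
     (\<forall>H1\<in>A - B. \<forall>H2\<in>A - B. H1 \<noteq> H2 \<longrightarrow>
        (\<forall>K\<in>components (H1 \<inter> H2). \<exists>H3\<in>B. K \<subseteq> H3))"

definition arr_TM_ideal :: "'g set \<Rightarrow> (complex^'g^'l) set set \<Rightarrow> (complex^'g^'l) set set \<Rightarrow> bool" where
  "arr_TM_ideal C A B \<equiv> arr_M_ideal C A B \<and>
     (\<forall>X\<in>Lpos C B. \<forall>H\<in>A - B. connected (X \<inter> H))"

end

theory Submission
  imports Defs
begin

text \<open>
  Near a point of a layer X, the layers containing X are cut out by linear conditions: through the
  universal covering, a layer is the image of a translate of W^g, where W is the common kernel in
  R^l of the characters of the hyperplanes containing it. Hence the rank of a layer is the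
  codimension of W, and every interval below a layer is the lattice of flats of a linear matroid.

  If Q is an M-ideal whose rank is one less than that of L(A), then a modular coatom y in Q and the
  join K of two atoms outside Q must satisfy y \<and> K \<noteq> 0, which gives the third hyperplane.
  Conversely, the arrangement condition says that a layer X outside L(B) is the join of the largest
  element of L(B) below X with any single hyperplane outside B. Each step therefore raises the rank
  by at most one, so along a chain of length equal to the rank it is raised by exactly one. This
  forces the character of a new hyperplane to be independent of those of B, so the hyperplane
  meets every layer of B.
\<close>

section \<open>Ranked posets with local joins\<close>

text \<open>The arrangement condition does not mention rank: adding to B a translate of one of its
  hypersurfaces gives an M-ideal of equal rank, and the translate misses the hypersurface, so |a
  \<or> y| \<ge> 1 fails. Hence a single step cannot be translated by itself from arrangements to
  posets, and the length of the chain has to enter.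

  In the other direction, y \<and> K \<noteq> 0 comes from a count of ranks. If y \<and> K were the
  minimum, modularity would give y \<and> (K \<or> z) = z for all z \<le> y. Then z \<mapsto> K
  \<or> z would be strictly increasing, and at least rk y steps would lead from K, of rank 2, to x,
  of rank at most rk y + 1.

  Two elements can have several minimal upper bounds, so joins and meets are always taken in the
  interval below a fixed x. On the topological side, everything rests on the fact that integrality
  keeps distinct flats with the same W a uniform distance apart.\<close>

locale layer_poset =
  fixes P :: "'x set" and le :: "'x \<Rightarrow> 'x \<Rightarrow> bool" and rk :: "'x \<Rightarrow> nat" and A :: "'x set" and bot :: 'x
  assumes fin: "finite P"
    and refl: "x \<in> P \<Longrightarrow> le x x"
    and antisym: "x \<in> P \<Longrightarrow> y \<in> P \<Longrightarrow> le x y \<Longrightarrow> le y x \<Longrightarrow> x = y"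
    and trans: "x \<in> P \<Longrightarrow> y \<in> P \<Longrightarrow> z \<in> P \<Longrightarrow> le x y \<Longrightarrow> le y z \<Longrightarrow> le x z"
    and bot_in: "bot \<in> P"
    and bot_le: "x \<in> P \<Longrightarrow> le bot x"
    and rk_bot: "rk bot = 0"
    and A_subset: "A \<subseteq> P"
    and rk_A: "a \<in> A \<Longrightarrow> rk a = 1"
    and local_join: "x \<in> P \<Longrightarrow> y \<in> P \<Longrightarrow> z \<in> P \<Longrightarrow> le y x \<Longrightarrow> le z x \<Longrightarrow>
      \<exists>j\<in>P. le y j \<and> le z j \<and> le j x \<and> (\<forall>v\<in>P. le v x \<longrightarrow> le y v \<longrightarrow> le z v \<longrightarrow> le j v)"
    and rk_less: "x \<in> P \<Longrightarrow> y \<in> P \<Longrightarrow> le x y \<Longrightarrow> x \<noteq> y \<Longrightarrow> rk x < rk y"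
    and rk_mub_atom: "y \<in> P \<Longrightarrow> a \<in> A \<Longrightarrow> \<not> le a y \<Longrightarrow> j \<in> mubs P le {y, a} \<Longrightarrow> rk j = Suc (rk y)"
    and atom_separates: "x \<in> P \<Longrightarrow> y \<in> P \<Longrightarrow> le x y \<Longrightarrow> x \<noteq> y \<Longrightarrow> \<exists>a\<in>A. le a y \<and> \<not> le a x"
begin

lemma A_in: "a \<in> A \<Longrightarrow> a \<in> P"
  using A_subset by blast

lemma rk_mono: "x \<in> P \<Longrightarrow> y \<in> P \<Longrightarrow> le x y \<Longrightarrow> rk x \<le> rk y"
  using rk_less by (metis less_or_eq_imp_le order_refl)

lemma eq_if_rk_ge: "x \<in> P \<Longrightarrow> y \<in> P \<Longrightarrow> le x y \<Longrightarrow> rk y \<le> rk x \<Longrightarrow> x = y"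
  using rk_less by (metis not_le)

lemma is_min_iff: "is_min P le z \<longleftrightarrow> z = bot"
  using bot_in bot_le antisym by (auto simp: is_min_def)

lemma partial_order: "partial_order_on' P le"
  unfolding partial_order_on'_def using refl antisym trans by blast

text \<open>The \<open>THE\<close> in \<open>join\<close> becomes usable once existence
  (\<open>local_join\<close>) and uniqueness (antisymmetry) are known. Leastness is claimed only
  among elements below x, because P may contain further minimal upper bounds.\<close>

lemma join_below:
  assumes "x \<in> P" "y \<in> P" "z \<in> P" "le y x" "le z x"
  defines "j \<equiv> join (below P le x) le y z"
  shows "j \<in> P" "le y j" "le z j" "le j x"
    "\<And>v. v \<in> P \<Longrightarrow> le v x \<Longrightarrow> le y v \<Longrightarrow> le z v \<Longrightarrow> le j v"
proof -
  obtain i where i: "i \<in> P" "le y i" "le z i" "le i x"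
    "\<And>v. v \<in> P \<Longrightarrow> le v x \<Longrightarrow> le y v \<Longrightarrow> le z v \<Longrightarrow> le i v"
    using local_join[OF assms(1-5)] by blast
  have "j = i"
    unfolding j_def join_def
    by (rule the_equality) (use i antisym in \<open>auto simp: ubs_def below_def\<close>)
  then show "j \<in> P" "le y j" "le z j" "le j x"
    "\<And>v. v \<in> P \<Longrightarrow> le v x \<Longrightarrow> le y v \<Longrightarrow> le z v \<Longrightarrow> le j v"
    using i by auto
qed

text \<open>An upper bound below the local join is itself below x, so local leastness gives
  minimality in all of P. This makes the rank axiom for \<open>mubs\<close> applicable to local
  joins.\<close>

lemma join_below_mub:
  assumes "x \<in> P" "y \<in> P" "z \<in> P" "le y x" "le z x"
  shows "join (below P le x) le y z \<in> mubs P le {y, z}"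
proof -
  let ?j = "join (below P le x) le y z"
  note j = join_below[OF assms]
  have "w = ?j" if w: "w \<in> P" "le y w" "le z w" "le w ?j" for w
    using antisym[OF w(1) j(1) w(4) j(5)[OF w(1) trans[OF w(1) j(1) assms(1) w(4) j(4)] w(2,3)]] .
  then show ?thesis using j by (auto simp: mubs_def ubs_def)
qed

lemma rk_join_atom:
  assumes "x \<in> P" "y \<in> P" "a \<in> A" "le y x" "le a x" "\<not> le a y"
  shows "rk (join (below P le x) le y a) = Suc (rk y)"
  by (rule rk_mub_atom[OF assms(2,3,6) join_below_mub[OF assms(1,2) A_in[OF assms(3)] assms(4,5)]])

lemma ex_max_rk:
  assumes "M \<subseteq> P" "M \<noteq> {}"
  obtains m where "m \<in> M" "\<And>v. v \<in> M \<Longrightarrow> rk v \<le> rk m"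
proof -
  have M: "finite M" using assms fin finite_subset by blast
  then have "Max (rk ` M) \<in> rk ` M" using assms(2) by (intro Max_in) auto
  then obtain m where m: "m \<in> M" "rk m = Max (rk ` M)" by auto
  show ?thesis
    by (rule that[OF m(1)]) (simp add: m(2) M)
qed

text \<open>A common lower bound m of maximal rank is the greatest one: its join below x with
  another common lower bound is again a common lower bound, so maximality forces this join to equal
  m.\<close>

lemma ex_meet:
  assumes "x \<in> P" "y \<in> P" "z \<in> P" "le y x" "le z x"
  shows "\<exists>m\<in>P. le m y \<and> le m z \<and> (\<forall>v\<in>P. le v y \<longrightarrow> le v z \<longrightarrow> le v m)"
proof -
  obtain m where m: "m \<in> {v \<in> P. le v y \<and> le v z}" "\<And>v. v \<in> {v \<in> P. le v y \<and> le v z} \<Longrightarrow> rk v \<le> rk m"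
    by (rule ex_max_rk[of "{v \<in> P. le v y \<and> le v z}"]) (use bot_in bot_le assms in auto)
  have "le v m" if v: "v \<in> P" "le v y" "le v z" for v
  proof -
    have x: "le m x" "le v x" using m(1) v assms trans by blast+
    note j = join_below[OF assms(1) _ v(1) x]
    have "join (below P le x) le m v \<in> {v \<in> P. le v y \<and> le v z}"
      using j m(1) v assms by auto
    then have "m = join (below P le x) le m v"
      using m j eq_if_rk_ge by auto
    then show ?thesis using j m(1) by (metis (no_types, lifting) mem_Collect_eq)
  qed
  then show ?thesis using m(1) by auto
qed

lemma meet_below:
  assumes "x \<in> P" "y \<in> P" "z \<in> P" "le y x" "le z x"
  defines "m \<equiv> meet (below P le x) le y z"
  shows "m \<in> P" "le m y" "le m z" "le m x"
    "\<And>v. v \<in> P \<Longrightarrow> le v y \<Longrightarrow> le v z \<Longrightarrow> le v m"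
proof -
  obtain i where i: "i \<in> P" "le i y" "le i z"
    "\<And>v. v \<in> P \<Longrightarrow> le v y \<Longrightarrow> le v z \<Longrightarrow> le v i"
    using ex_meet[OF assms(1-5)] by blast
  have ix: "le i x" using i assms trans by blast
  have "m = i"
    unfolding m_def meet_def
    by (rule the_equality) (use i ix antisym in \<open>auto simp: lbs_def below_def\<close>)
  then show "m \<in> P" "le m y" "le m z" "le m x"
    "\<And>v. v \<in> P \<Longrightarrow> le v y \<Longrightarrow> le v z \<Longrightarrow> le v m"
    using i ix by auto
qed

text \<open>An atom a separating a covering pair gives x < x \<or> a \<le> y, hence y = x \<or> a,
  one rank higher. Conversely, a strictly monotone rank leaves no room between n and n + 1.\<close>

lemma covers_iff:
  assumes "x \<in> P" "y \<in> P"
  shows "covers P le x y \<longleftrightarrow> le x y \<and> rk y = Suc (rk x)"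
proof
  assume c: "covers P le x y"
  then have xy: "le x y" "x \<noteq> y" by (auto simp: covers_def)
  obtain a where a: "a \<in> A" "le a y" "\<not> le a x"
    using atom_separates[OF assms xy] by blast
  note j = join_below[OF assms(2,1) A_in[OF a(1)] xy(1) a(2)]
  have "join (below P le y) le x a = y"
    using c j(1-4) a(3) unfolding covers_def by metis
  then show "le x y \<and> rk y = Suc (rk x)"
    using rk_join_atom[OF assms(2,1) a(1) xy(1) a(2,3)] xy by simp
next
  assume r: "le x y \<and> rk y = Suc (rk x)"
  have False if "z \<in> P" "le x z" "le z y" "z \<noteq> x" "z \<noteq> y" for z
    using rk_less[of x z] rk_less[of z y] that assms r by auto
  then show "covers P le x y"
    using r assms by (auto simp: covers_def)
qed

lemma atoms_eq: "atoms P le = A"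
proof
  show "A \<subseteq> atoms P le"
    by (auto simp: atoms_def is_min_iff covers_iff bot_in A_in bot_le rk_A rk_bot)
  show "atoms P le \<subseteq> A"
  proof
    fix a assume "a \<in> atoms P le"
    then have a: "a \<in> P" "rk a = 1" "le bot a"
      by (auto simp: atoms_def is_min_iff covers_iff bot_in rk_bot)
    then have "bot \<noteq> a" using rk_bot by auto
    then obtain b where b: "b \<in> A" "le b a"
      using atom_separates[OF bot_in a(1,3)] by blast
    then have "b = a" using eq_if_rk_ge[OF A_in[OF b(1)] a(1) b(2)] rk_A[OF b(1)] a by simp
    then show "a \<in> A" using b by simp
  qed
qed

text \<open>Atoms and covers of an interval are computed inside that interval, so the axioms are
  transferred to it and \<open>atoms_eq\<close> and \<open>covers_iff\<close> are reused
  there.\<close>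

lemma layer_poset_below:
  assumes x: "x \<in> P"
  shows "layer_poset (below P le x) le rk {a \<in> A. le a x} bot"
proof
  show "\<exists>j\<in>below P le x. le y j \<and> le z j \<and> le j u \<and> (\<forall>v\<in>below P le x. le v u \<longrightarrow> le y v \<longrightarrow> le z v \<longrightarrow> le j v)"
    if "u \<in> below P le x" "y \<in> below P le x" "z \<in> below P le x" "le y u" "le z u" for u y z
  proof -
    have m: "u \<in> P" "y \<in> P" "z \<in> P" "le u x" using that by (auto simp: below_def)
    note j = join_below[OF m(1-3) that(4,5)]
    have "le (join (below P le u) le y z) x" using trans[OF j(1) m(1) x j(4) m(4)] .
    then show ?thesis
      using j by (intro bexI[of _ "join (below P le u) le y z"]) (auto simp: below_def)
  qed
  show "rk j = Suc (rk y)"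
    if "y \<in> below P le x" "a \<in> {a \<in> A. le a x}" "\<not> le a y" "j \<in> mubs (below P le x) le {y, a}" for y a j
  proof -
    have "j \<in> mubs P le {y, a}"
      using that(4) trans[OF _ _ x] by (auto simp: mubs_def ubs_def below_def)
    then show ?thesis using that rk_mub_atom by (auto simp: below_def)
  qed
  show "\<exists>a\<in>{a \<in> A. le a x}. le a z \<and> \<not> le a y"
    if "y \<in> below P le x" "z \<in> below P le x" "le y z" "y \<noteq> z" for y z
  proof -
    have m: "y \<in> P" "z \<in> P" "le z x" using that by (auto simp: below_def)
    then show ?thesis
      using atom_separates[OF m(1,2) that(3,4)] trans[OF A_in m(2) x _ m(3)] by blast
  qed
  show "le y w" if "y \<in> below P le x" "z \<in> below P le x" "w \<in> below P le x" "le y z" "le z w" for y z w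
    using that trans by (auto simp: below_def)
qed (use fin refl antisym bot_in bot_le rk_bot A_in rk_A rk_less x in \<open>auto simp: below_def\<close>)

lemma geometric_below:
  assumes x: "x \<in> P"
  shows "geometric_lattice (below P le x) le"
proof -
  interpret L: layer_poset "below P le x" le rk "{a \<in> A. le a x}" bot
    by (rule layer_poset_below[OF x])
  have lat: "is_lattice (below P le x) le"
    unfolding is_lattice_def
  proof (intro ballI conjI)
    fix y z assume "y \<in> below P le x" "z \<in> below P le x"
    then have m: "y \<in> P" "z \<in> P" "le y x" "le z x" by (auto simp: below_def)
    show "\<exists>j\<in>ubs (below P le x) le {y, z}. \<forall>w\<in>ubs (below P le x) le {y, z}. le j w"
      by (rule bexI[of _ "join (below P le x) le y z"])
         (use join_below[OF x m] in \<open>auto simp: ubs_def below_def\<close>)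
    show "\<exists>j\<in>lbs (below P le x) le {y, z}. \<forall>w\<in>lbs (below P le x) le {y, z}. le w j"
      by (rule bexI[of _ "meet (below P le x) le y z"])
         (use meet_below[OF x m] in \<open>auto simp: lbs_def below_def\<close>)
  qed
  have "covers (below P le x) le y z \<longleftrightarrow> (\<exists>a\<in>atoms (below P le x) le. \<not> le a y \<and> z = join (below P le x) le y a)"
    if "y \<in> below P le x" "z \<in> below P le x" for y z
  proof -
    have m: "y \<in> P" "z \<in> P" "le y x" "le z x" using that by (auto simp: below_def)
    show ?thesis
      unfolding L.atoms_eq L.covers_iff[OF that]
    proof safe
      assume yz: "le y z" "rk z = Suc (rk y)"
      then have "y \<noteq> z" by auto
      then obtain a where a: "a \<in> A" "le a z" "\<not> le a y"
        using atom_separates[OF m(1,2) yz(1)] by blast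
      have ax: "le a x" using trans[OF A_in[OF a(1)] m(2) x a(2) m(4)] .
      note j = join_below[OF x m(1) A_in[OF a(1)] m(3) ax]
      have "join (below P le x) le y a = z"
        using eq_if_rk_ge[OF j(1) m(2) j(5)[OF m(2,4) yz(1) a(2)]]
          rk_join_atom[OF x m(1) a(1) m(3) ax a(3)] yz(2) by simp
      then show "\<exists>a\<in>{a \<in> A. le a x}. \<not> le a y \<and> z = join (below P le x) le y a"
        using a ax by blast
    next
      fix a assume a: "a \<in> A" "le a x" "\<not> le a y"
      show "le y (join (below P le x) le y a)"
        using join_below[OF x m(1) A_in[OF a(1)] m(3) a(2)] by blast
      show "rk (join (below P le x) le y a) = Suc (rk y)"
        by (rule rk_join_atom[OF x m(1) a(1) m(3) a(2,3)])
    qed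
  qed
  then show ?thesis using lat by (auto simp: geometric_lattice_def)
qed

lemma locally_geometric: "locally_geometric P le"
proof -
  have "ranked P le"
    unfolding ranked_def
  proof (intro exI[of _ rk] conjI allI impI)
    fix x y assume c: "covers P le x y"
    then have "x \<in> P" "y \<in> P" by (auto simp: covers_def)
    then show "rk y = Suc (rk x)" using c covers_iff by blast
  qed (simp add: is_min_iff rk_bot)
  then show ?thesis
    using fin partial_order is_min_iff geometric_below
    by (auto simp: locally_geometric_def good_poset_def)
qed

section \<open>Rank as length of longest chains\<close>

lemma ex_lower_cover:
  assumes "x \<in> P" "rk x = Suc n"
  obtains y where "y \<in> P" "le y x" "rk y = n"
proof -
  have "bot \<noteq> x" using assms rk_bot by auto
  then obtain y where y: "y \<in> {v \<in> P. le v x \<and> v \<noteq> x}" "\<And>v. v \<in> {v \<in> P. le v x \<and> v \<noteq> x} \<Longrightarrow> rk v \<le> rk y"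
    by (metis (mono_tags, lifting) ex_max_rk[of "{v \<in> P. le v x \<and> v \<noteq> x}"] mem_Collect_eq
        subsetI empty_iff bot_in bot_le assms(1))
  then have m: "y \<in> P" "le y x" "y \<noteq> x" by auto
  obtain a where a: "a \<in> A" "le a x" "\<not> le a y"
    using atom_separates[OF m(1) assms(1) m(2,3)] by blast
  note j = join_below[OF assms(1) m(1) A_in[OF a(1)] m(2) a(2)]
  have r: "rk (join (below P le x) le y a) = Suc (rk y)"
    by (rule rk_join_atom[OF assms(1) m(1) a(1) m(2) a(2,3)])
  have "join (below P le x) le y a = x"
    using y(2)[of "join (below P le x) le y a"] j r by fastforce
  then show ?thesis using r assms that[OF m(1,2)] by simp
qed

lemma ex_maximal_chain:
  assumes "x \<in> P"
  shows "\<exists>c. is_chain (below P le x) le c \<and> c \<noteq> {} \<and> card c = Suc (rk x)"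
  using assms
proof (induction "rk x" arbitrary: x)
  case 0
  then show ?case
    using refl by (intro exI[of _ "{x}"]) (auto simp: is_chain_def below_def)
next
  case (Suc n)
  obtain y where y: "y \<in> P" "le y x" "rk y = n"
    using ex_lower_cover[OF Suc.prems] Suc.hyps(2) by metis
  obtain c where c: "is_chain (below P le y) le c" "card c = Suc n"
    using Suc.hyps(1)[of y] y by auto
  have le_x: "le v x" "v \<noteq> x" "v \<in> P" if "v \<in> c" for v
  proof -
    have v: "v \<in> P" "le v y" using that c(1) by (auto simp: is_chain_def below_def)
    show "v \<in> P" by fact
    show "le v x" using trans[OF v(1) y(1) Suc.prems v(2) y(2)] .
    show "v \<noteq> x" using rk_mono[OF v(1) y(1) v(2)] y Suc.hyps(2) by auto
  qed
  have "finite c" using c(2) card.infinite by fastforce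
  moreover have "x \<notin> c" using le_x(2) by blast
  ultimately have "card (insert x c) = Suc (rk x)"
    using c(2) Suc.hyps(2) by simp
  moreover have "is_chain (below P le x) le (insert x c)"
    using le_x refl[OF Suc.prems] Suc.prems c(1) by (auto simp: is_chain_def below_def)
  ultimately show ?case by blast
qed

text \<open>On a chain below x the rank is injective with values at most rk x, which bounds the size
  by rk x + 1; successive lower covers build a chain of exactly this size.\<close>

lemma prk_eq:
  assumes x: "x \<in> P"
  shows "prk P le x = rk x"
  unfolding prk_def
proof (rule Max_eqI)
  have fb: "finite (below P le x)" using fin by (simp add: below_def)
  have "{card c - 1 |c. is_chain (below P le x) le c \<and> c \<noteq> {}} \<subseteq> (\<lambda>c. card c - 1) ` Pow (below P le x)"
    by (auto simp: is_chain_def)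
  then show "finite {card c - 1 |c. is_chain (below P le x) le c \<and> c \<noteq> {}}"
    using fb finite_subset by blast
  show "n \<le> rk x" if n: "n \<in> {card c - 1 |c. is_chain (below P le x) le c \<and> c \<noteq> {}}" for n
  proof -
    obtain c where c: "is_chain (below P le x) le c" "n = card c - 1" using n by blast
    have cP: "v \<in> P \<and> le v x" if "v \<in> c" for v
      using that c(1) by (auto simp: is_chain_def below_def)
    have "inj_on rk c"
    proof (rule inj_onI)
      fix u v assume uv: "u \<in> c" "v \<in> c" "rk u = rk v"
      then have "le u v \<or> le v u" using c(1) by (auto simp: is_chain_def)
      then show "u = v" using rk_less[of u v] rk_less[of v u] cP uv by auto
    qed
    moreover have "rk ` c \<subseteq> {..rk x}" using cP rk_mono x by auto
    ultimately have "card c \<le> card {..rk x}" by (intro card_inj_on_le) auto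
    then show ?thesis using c by simp
  qed
  obtain c where "is_chain (below P le x) le c" "c \<noteq> {}" "card c = Suc (rk x)"
    using ex_maximal_chain[OF x] by blast
  then show "rk x \<in> {card c - 1 |c. is_chain (below P le x) le c \<and> c \<noteq> {}}"
    by (auto intro!: exI[of _ c])
qed

lemma poset_rank_eq: "poset_rank P le = Max (rk ` P)"
  unfolding poset_rank_def by (simp add: prk_eq cong: image_cong_simp)

lemma rk_le_poset_rank: "x \<in> P \<Longrightarrow> rk x \<le> poset_rank P le"
  using fin by (simp add: poset_rank_eq)

lemma ex_maximal_above:
  assumes "x \<in> P"
  obtains m where "m \<in> maximals P le" "le x m"
proof -
  obtain m where m: "m \<in> {v \<in> P. le x v}" "\<And>v. v \<in> {v \<in> P. le x v} \<Longrightarrow> rk v \<le> rk m"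
    by (rule ex_max_rk[of "{v \<in> P. le x v}"]) (use assms refl in auto)
  have "m \<in> maximals P le"
  proof -
    have mP: "m \<in> P" "le x m" using m(1) by auto
    have "y = m" if y: "y \<in> P" "le m y" for y
      using m(2)[of y] trans[OF assms mP(1) y(1) mP(2) y(2)] eq_if_rk_ge[OF mP(1) y] y(1) by simp
    then show ?thesis using mP by (auto simp: maximals_def)
  qed
  then show ?thesis using that m by auto
qed

lemma rk_maximal_if_pure:
  assumes "pure P le" "x \<in> maximals P le"
  shows "rk x = poset_rank P le"
proof -
  have "poset_rank P le \<in> rk ` P"
    unfolding poset_rank_eq using fin bot_in by (intro Max_in) auto
  then obtain y where y: "y \<in> P" "rk y = poset_rank P le" by auto
  then have "y \<in> maximals P le"
    unfolding maximals_def using eq_if_rk_ge[OF y(1)] rk_le_poset_rank by auto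
  then have "prk P le x = prk P le y"
    using assms unfolding pure_def by blast
  then show ?thesis
    using prk_eq[of x] prk_eq[of y] y assms(2) by (simp add: maximals_def)
qed

text \<open>The required atom is any atom below y \<and> K, where x is a maximal element above K and
  y is a modular maximal element of Q below x. The rank hypothesis says that y has corank at most
  one below x.\<close>

lemma M_ideal_imp_atom_below_mub:
  assumes Q: "layer_poset Q le rk B bot" "order_ideal P le Q" "pure Q le" "modular_cond P le Q"
    and rank: "poset_rank P le \<le> Suc (poset_rank Q le)"
    and H: "H \<in> A - Q" "H' \<in> A - Q" "H \<noteq> H'"
    and K: "K \<in> mubs P le {H, H'}"
  shows "\<exists>a\<in>A \<inter> Q. le a K"
proof -
  interpret Q: layer_poset Q le rk B bot by fact
  have KP: "K \<in> P" "le H K" "le H' K" using K by (auto simp: mubs_def ubs_def)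
  have HP: "H \<in> P" "H' \<in> P" "rk H = 1" "rk H' = 1" using H A_in rk_A by auto
  have "\<not> le H' H" using eq_if_rk_ge[OF HP(2,1)] HP H by auto
  then have rkK: "rk K = 2"
    using rk_mub_atom[OF HP(1) _ _ K] H HP by simp
  obtain x where x: "x \<in> maximals P le" "le K x" using ex_maximal_above[OF KP(1)] by blast
  then have xP: "x \<in> P" by (simp add: maximals_def)
  obtain y where y: "y \<in> maximals Q le" "le y x" "modular_elem (below P le x) le y"
    using Q(4) x by (auto simp: modular_cond_def)
  have yQ: "y \<in> Q" using y by (simp add: maximals_def)
  then have yP: "y \<in> P" using Q(2) by (auto simp: order_ideal_def)
  have rky: "rk y = poset_rank Q le" using Q.rk_maximal_if_pure[OF Q(3) y(1)] .
  have rkx: "rk x \<le> Suc (rk y)" using rk_le_poset_rank[OF xP] rank rky by simp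
  let ?J = "join (below P le x) le" and ?M = "meet (below P le x) le"
  note m = meet_below[OF xP yP KP(1) y(2) x(2)]
  have "?M y K \<noteq> bot"
  proof
    assume bot: "?M y K = bot"
    \<comment> \<open>Modularity with y \<and> K = \<open>bot\<close> makes z \<mapsto> K \<or> z
      injective on the interval below y.\<close>
    have yJ: "?M y (?J K z) = z" if z: "z \<in> P" "le z y" for z
    proof -
      have zx: "le z x" using trans[OF z(1) yP xP z(2) y(2)] .
      have "?M y (?J K z) = ?J bot z"
        using y(3) z zx KP x(2) bot unfolding modular_elem_def below_def by auto
      also have "\<dots> = z"
        using join_below[OF xP bot_in z(1) bot_le[OF xP] zx] antisym z(1) bot_le[OF z(1)] zx refl by metis
      finally show ?thesis .
    qed
    \<comment> \<open>Induction on rk y - rk z, starting at z = y. Passing from z to z \<or> a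
      raises rk z by one and K \<or> z strictly, so the climb from K \<or> z to x is at least as
      long as the one from z to y.\<close>
    have "rk (?J K z) + rk y \<le> rk x + rk z" if "z \<in> P" "le z y" for z
      using that
    proof (induction "rk y - rk z" arbitrary: z rule: less_induct)
      case less
      have zx: "le z x" using trans[OF less.prems(1) yP xP less.prems(2) y(2)] .
      note j = join_below[OF xP KP(1) less.prems(1) x(2) zx]
      show ?case
      proof (cases "z = y")
        case True
        then show ?thesis using rk_mono[OF j(1) xP j(4)] by simp
      next
        case False
        obtain a where a: "a \<in> A" "le a y" "\<not> le a z"
          using atom_separates[OF less.prems(1) yP less.prems(2) False] by blast
        define w where "w = join (below P le y) le z a"
        note w = join_below[OF yP less.prems(1) A_in[OF a(1)] less.prems(2) a(2), folded w_def]
        have rkw: "rk w = Suc (rk z)"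
          unfolding w_def by (rule rk_join_atom[OF yP less.prems(1) a(1) less.prems(2) a(2,3)])
        have wx: "le w x" using trans[OF w(1) yP xP w(4) y(2)] .
        note jw = join_below[OF xP KP(1) w(1) x(2) wx]
        have "le (?J K z) (?J K w)"
          using j(5)[OF jw(1,4,2)] trans[OF less.prems(1) w(1) jw(1) w(2) jw(3)] by blast
        moreover have "?J K z \<noteq> ?J K w"
          using yJ[OF less.prems] yJ[OF w(1,4)] rkw by (metis n_not_Suc_n)
        ultimately have "rk (?J K z) < rk (?J K w)"
          using rk_less j(1) jw(1) by blast
        moreover have "rk w \<le> rk y" using rk_mono[OF w(1) yP w(4)] .
        then have "rk (?J K w) + rk y \<le> rk x + rk w"
          using less.hyps[of w] rkw w by auto
        ultimately show ?thesis using rkw by simp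
      qed
    qed
    \<comment> \<open>At the bottom the bound yields 2 + rk y \<le> rk x, against rk x \<le> rk y +
      1.\<close>
    from this[OF bot_in bot_le[OF yP]] have "rk (?J K bot) + rk y \<le> rk x"
      by (simp add: rk_bot)
    moreover have "rk K \<le> rk (?J K bot)"
      using join_below[OF xP KP(1) bot_in x(2) bot_le[OF xP]] rk_mono KP(1) by blast
    ultimately show False using rkK rkx by simp
  qed
  then obtain a where a: "a \<in> A" "le a (?M y K)"
    using atom_separates[OF bot_in m(1) bot_le[OF m(1)]] by metis
  have "le a y" "le a K"
    using trans[OF A_in[OF a(1)] m(1) _ a(2)] m yP KP by blast+
  then show ?thesis
    using a(1) Q(2) yQ A_in by (auto simp: order_ideal_def)
qed

end

text \<open>The assumption atom_below_mub is what the condition on H1, H2, H3 in the arrangement sense of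
  M-ideals becomes in the poset of layers.\<close>
locale layer_poset_ideal = layer_poset +
  fixes Q
  assumes ideal: "order_ideal P le Q"
    and join_closed: "join_closed P le Q"
    and bot_in_Q: "bot \<in> Q"
    and atom_below_mub: "H \<in> A - Q \<Longrightarrow> H' \<in> A - Q \<Longrightarrow> H \<noteq> H' \<Longrightarrow> K \<in> mubs P le {H, H'} \<Longrightarrow>
      \<exists>a\<in>A \<inter> Q. le a K"
begin

section \<open>Largest elements of the ideal below a given element\<close>

lemma Q_in: "y \<in> Q \<Longrightarrow> y \<in> P"
  and Q_down: "y \<in> Q \<Longrightarrow> z \<in> P \<Longrightarrow> le z y \<Longrightarrow> z \<in> Q"
  using ideal by (auto simp: order_ideal_def)

lemma join_in_Q:
  assumes "x \<in> P" "y \<in> Q" "z \<in> Q" "le y x" "le z x"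
  shows "join (below P le x) le y z \<in> Q"
proof -
  have "mubs P le {y, z} \<subseteq> Q"
    using join_closed assms(2,3) by (simp add: join_closed_def)
  then show ?thesis
    using join_below_mub[OF assms(1) Q_in[OF assms(2)] Q_in[OF assms(3)] assms(4,5)] by blast
qed

text \<open>A relation and not a function, since existence rests on join-closedness of Q and comes
  only with \<open>ex_trace\<close>.\<close>

definition trace :: "'a \<Rightarrow> 'a \<Rightarrow> bool" where
  "trace x y \<longleftrightarrow> y \<in> Q \<and> le y x \<and> (\<forall>w\<in>Q. le w x \<longrightarrow> le w y)"

text \<open>An element of maximal rank in Q below x absorbs every other one, because their join
  below x stays in Q.\<close>

lemma ex_trace:
  assumes x: "x \<in> P"
  obtains y where "trace x y"
proof -
  obtain y where y: "y \<in> {v \<in> Q. le v x}" "\<And>v. v \<in> {v \<in> Q. le v x} \<Longrightarrow> rk v \<le> rk y"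
    by (rule ex_max_rk[of "{v \<in> Q. le v x}"]) (use bot_in_Q bot_le x Q_in in auto)
  have "le w y" if w: "w \<in> Q" "le w x" for w
  proof -
    have m: "y \<in> P" "w \<in> P" "le y x" using y(1) w Q_in by auto
    note j = join_below[OF x m w(2)]
    have "join (below P le x) le y w \<in> Q" using join_in_Q x y(1) w by auto
    then have "y = join (below P le x) le y w"
      using y(2) j eq_if_rk_ge[OF m(1) j(1,2)] by auto
    then show ?thesis using j(3) by simp
  qed
  then show ?thesis using that y(1) by (auto simp: trace_def)
qed

text \<open>Suppose y \<or> H misses an atom H' \<le> x. Then H' is outside Q, and K = H \<or> H'
  has an atom a \<in> Q below it. Both K and H \<or> a have rank 2, so K = H \<or> a. As a \<le> y,
  K lies below y \<or> H, and H' with it.\<close>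

lemma join_trace_atom:
  assumes x: "x \<in> P" and y: "trace x y" and H: "H \<in> A" "H \<notin> Q" "le H x"
  shows "join (below P le x) le y H = x" "rk x = Suc (rk y)"
proof -
  let ?j = "join (below P le x) le y H"
  have yQ: "y \<in> Q" "y \<in> P" "le y x" and ymax: "\<And>w. w \<in> Q \<Longrightarrow> le w x \<Longrightarrow> le w y"
    using y Q_in by (auto simp: trace_def)
  have HP: "H \<in> P" "rk H = 1" using H A_in rk_A by auto
  note j = join_below[OF x yQ(2) HP(1) yQ(3) H(3)]
  show eq: "?j = x"
  proof (rule ccontr)
    assume "?j \<noteq> x"
    then obtain H' where H': "H' \<in> A" "le H' x" "\<not> le H' ?j"
      using atom_separates[OF j(1) x j(4)] by blast
    then have H'P: "H' \<in> P" "rk H' = 1" using A_in rk_A by auto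
    have "H' \<notin> Q" using ymax[OF _ H'(2)] H'(3) trans[OF H'P(1) yQ(2) j(1) _ j(2)] by blast
    have "H \<noteq> H'" using H'(3) j(3) by auto
    define K where "K = join (below P le x) le H H'"
    note K = join_below[OF x HP(1) H'P(1) H(3) H'(2), folded K_def]
    have Kmub: "K \<in> mubs P le {H, H'}"
      unfolding K_def by (rule join_below_mub[OF x HP(1) H'P(1) H(3) H'(2)])
    obtain a where a: "a \<in> A" "a \<in> Q" "le a K"
      using atom_below_mub[OF _ _ \<open>H \<noteq> H'\<close> Kmub] H H' \<open>H' \<notin> Q\<close> by blast
    have aP: "a \<in> P" "rk a = 1" using a A_in rk_A by auto
    have "\<not> le H' H" using eq_if_rk_ge[OF H'P(1) HP(1)] \<open>H \<noteq> H'\<close> HP H'P by auto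
    then have rkK: "rk K = 2"
      using rk_mub_atom[OF HP(1) H'(1) _ Kmub] HP by simp
    have "\<not> le a H" using eq_if_rk_ge[OF aP(1) HP(1)] HP aP a H by auto
    then have rkHa: "rk (join (below P le K) le H a) = 2"
      using rk_join_atom[OF K(1) HP(1) a(1) K(2) a(3)] HP by simp
    note i = join_below[OF K(1) HP(1) aP(1) K(2) a(3)]
    have KHa: "join (below P le K) le H a = K"
      using eq_if_rk_ge[OF i(1) K(1) i(4)] rkK rkHa by simp
    have ax: "le a x" using trans[OF aP(1) K(1) x a(3) K(4)] .
    have "le a y" using ymax[OF a(2) ax] .
    then have "le a ?j" using trans[OF aP(1) yQ(2) j(1) _ j(2)] by blast
    \<comment> \<open>K is known as the least upper bound of H and a only inside the interval below
      K, so the comparison passes through K \<and> (y \<or> H), which lies in that interval.\<close>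
    have "le K ?j"
    proof -
      define M where "M = meet (below P le x) le K ?j"
      note M = meet_below[OF x K(1) j(1) K(4) j(4), folded M_def]
      have "le H M" "le a M" using M(5) K(2) j(3) HP(1) a(3) \<open>le a ?j\<close> aP(1) by auto
      then have "le K M" using i(5)[OF M(1,2)] KHa by simp
      then show ?thesis using trans[OF K(1) M(1) j(1) _ M(3)] by blast
    qed
    then show False using H'(3) trans[OF H'P(1) K(1) j(1) K(3)] by blast
  qed
  have "\<not> le H y" using Q_down[OF yQ(1) HP(1)] H by blast
  then show "rk x = Suc (rk y)"
    using rk_join_atom[OF x yQ(2) H(1) yQ(3) H(3)] eq by simp
qed

text \<open>An atom below x but not below the trace of x cannot belong to Q, by maximality of the
  trace.\<close>

lemma ex_atom_not_in_Q:
  assumes "x \<in> P" "x \<notin> Q"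
  obtains H where "H \<in> A" "H \<notin> Q" "le H x"
proof -
  obtain y where y: "trace x y" using ex_trace[OF assms(1)] .
  then have "y \<in> P" "le y x" "y \<noteq> x" using Q_in assms by (auto simp: trace_def)
  then obtain H where "H \<in> A" "le H x" "\<not> le H y"
    using atom_separates[OF _ assms(1)] by blast
  then show ?thesis using that y by (auto simp: trace_def)
qed

lemma rk_le_trace:
  assumes "x \<in> P" "trace x y"
  shows "rk x \<le> Suc (rk y)"
proof (cases "x \<in> Q")
  case True
  then have "le x y" using assms refl by (auto simp: trace_def)
  then show ?thesis using assms Q_in rk_mono[of x y] by (auto simp: trace_def)
next
  case False
  then show ?thesis
    using join_trace_atom(2)[OF assms] ex_atom_not_in_Q[OF assms(1)] by (metis order_refl)
qed

text \<open>For u \<le> x the element y \<and> u is the trace of u, so an element outside Q has rank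
  exactly one more than its meet with y. The inequality (y \<and> u) \<or> z \<le> y \<and> (u \<or>
  z) holds for all z \<le> y, and a count of ranks turns it into an equality.\<close>

lemma trace_modular:
  assumes x: "x \<in> P" and y: "trace x y"
  shows "modular_elem (below P le x) le y"
proof -
  let ?J = "join (below P le x) le" and ?M = "meet (below P le x) le"
  have yQ: "y \<in> Q" "y \<in> P" "le y x" and ymax: "\<And>w. w \<in> Q \<Longrightarrow> le w x \<Longrightarrow> le w y"
    using y Q_in by (auto simp: trace_def)
  have tr: "trace u (?M y u)" if u: "u \<in> P" "le u x" for u
  proof -
    note m = meet_below[OF x yQ(2) u(1) yQ(3) u(2)]
    have "le w (?M y u)" if w: "w \<in> Q" "le w u" for w
      using m(5)[OF Q_in[OF w(1)] ymax[OF w(1)] w(2)] trans[OF Q_in[OF w(1)] u(1) x w(2) u(2)] by blast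
    then show ?thesis using m Q_down[OF yQ(1) m(1,2)] by (auto simp: trace_def)
  qed
  have "?M y (?J u z) = ?J (?M y u) z" if "u \<in> below P le x" "z \<in> below P le x" "le z y" for u z
  proof -
    have uz: "u \<in> P" "z \<in> P" "le u x" "le z x" using that by (auto simp: below_def)
    note j = join_below[OF x uz]
    note m = meet_below[OF x yQ(2) uz(1) yQ(3) uz(3)]
    note t = meet_below[OF x yQ(2) j(1) yQ(3) j(4)]
    note v = join_below[OF x m(1) uz(2) m(4) uz(4)]
    have vj: "le (?J (?M y u) z) (?J u z)"
      using v(5)[OF j(1,4) _ j(3)] trans[OF m(1) uz(1) j(1) m(3) j(2)] by blast
    have vy: "le (?J (?M y u) z) y"
      using v(5)[OF yQ(2,3) m(2) that(3)] .
    have vt: "le (?J (?M y u) z) (?M y (?J u z))"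
      using t(5)[OF v(1) vy vj] .
    have "rk (?M y (?J u z)) \<le> rk (?J (?M y u) z)"
    proof (cases "u \<in> Q")
      case True
      then have uy: "le u y" using ymax uz by blast
      have "le u (?M y u)" using m(5)[OF uz(1) uy refl[OF uz(1)]] .
      then have "le u (?J (?M y u) z)" using trans[OF uz(1) m(1) v(1) _ v(2)] by blast
      then have "le (?J u z) (?J (?M y u) z)" using j(5)[OF v(1,4) _ v(3)] by blast
      then show ?thesis
        using rk_mono[OF j(1) v(1)] rk_mono[OF t(1) j(1) t(3)] by simp
    next
      case False
      \<comment> \<open>Put v = (y \<and> u) \<or> z. From u = (y \<and> u) \<or> H follows u \<or>
        z \<le> v \<or> H, so rk (u \<or> z) \<le> rk v + 1, while rk (u \<or> z) = rk (y \<and> (u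
        \<or> z)) + 1.\<close>
      then obtain H where H: "H \<in> A" "H \<notin> Q" "le H u" using ex_atom_not_in_Q[OF uz(1)] by blast
      then have HP: "H \<in> P" using A_in by blast
      have Hj: "le H (?J u z)" using trans[OF HP uz(1) j(1) H(3) j(2)] .
      have Hx: "le H x" using trans[OF HP uz(1) x H(3) uz(3)] .
      have rj: "rk (?J u z) = Suc (rk (?M y (?J u z)))"
        using join_trace_atom(2)[OF j(1) tr[OF j(1,4)] H(1,2) Hj] .
      have "\<not> le H (?J (?M y u) z)"
        using H(2) Q_down[OF yQ(1) HP] trans[OF HP v(1) yQ(2) _ vy] by blast
      then have rw: "rk (?J (?J (?M y u) z) H) = Suc (rk (?J (?M y u) z))"
        using rk_join_atom[OF x v(1) H(1) v(4) Hx] by blast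
      note w = join_below[OF x v(1) HP v(4) Hx]
      have ju: "join (below P le u) le (?M y u) H = u"
        using join_trace_atom(1)[OF uz(1) tr[OF uz(1,3)] H] .
      have uw: "le u (?J (?J (?M y u) z) H)"
      proof -
        let ?w = "?J (?J (?M y u) z) H"
        note n = meet_below[OF x uz(1) w(1) uz(3) w(4)]
        have "le (?M y u) ?w" using trans[OF m(1) v(1) w(1) v(2) w(2)] .
        then have "le (?M y u) (?M u ?w)" "le H (?M u ?w)"
          using n(5)[OF m(1) m(3)] n(5)[OF HP H(3) w(3)] by auto
        then have "le u (?M u ?w)"
          using join_below(5)[OF uz(1) m(1) HP m(3) H(3) n(1,2)] ju by simp
        then show ?thesis using trans[OF uz(1) n(1) w(1) _ n(3)] by blast
      qed
      have "le z (?J (?J (?M y u) z) H)" using trans[OF uz(2) v(1) w(1) v(3) w(2)] .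
      then have "rk (?J u z) \<le> rk (?J (?J (?M y u) z) H)"
        using rk_mono[OF j(1) w(1)] j(5)[OF w(1,4) uw] by blast
      then show ?thesis using rj rw by simp
    qed
    then show ?thesis using eq_if_rk_ge[OF v(1) t(1) vt] by simp
  qed
  then show ?thesis using yQ by (auto simp: modular_elem_def below_def)
qed

end

section \<open>Flats in the group T\<close>

definition rvec :: "int^'l \<Rightarrow> real^'l" where
  "rvec \<alpha> = (\<chi> i. of_int (\<alpha>$i))"

definition ann :: "(int^'l) set \<Rightarrow> (real^'l) set" where
  "ann F = {v. \<forall>\<alpha>\<in>F. rvec \<alpha> \<bullet> v = 0}"

text \<open>This is W^g. In \<open>real^'g^'l\<close> the rows are indexed by the generators of
  \<Gamma>, so the copy of R^l attached to one coordinate of G is a column.\<close>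

definition colspace :: "(real^'l) set \<Rightarrow> (real^'g^'l) set" where
  "colspace W = {\<delta>. \<forall>j. column j \<delta> \<in> W}"

definition flat :: "'g set \<Rightarrow> real^'g^'l \<Rightarrow> (real^'l) set \<Rightarrow> (complex^'g^'l) set" where
  "flat C \<theta> W = (\<lambda>\<delta>. cover C (\<theta> + \<delta>)) ` colspace W"

text \<open>The kernel of \<open>cover C\<close>, seen as a homomorphism from the additive group of
  matrices to T.\<close>

definition periods :: "'g set \<Rightarrow> (real^'g^'l) set" where
  "periods C = {n. \<forall>i j. if j \<in> C then n$i$j \<in> \<int> else n$i$j = 0}"

lemma column_nth [simp]: "column j \<theta> $ i = \<theta>$i$j"
  by (simp add: column_def)

lemma column_add: "column j (\<theta> + \<theta>') = column j \<theta> + column j \<theta>'"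
  and column_diff: "column j (\<theta> - \<theta>') = column j \<theta> - column j \<theta>'"
  and column_scaleR: "column j (t *\<^sub>R \<theta>) = t *\<^sub>R column j \<theta>"
  and column_zero [simp]: "column j 0 = 0"
  for \<theta> \<theta>' :: "real^'g^'l"
  by (simp_all add: vec_eq_iff)

lemma subspace_ann [simp]: "subspace (ann F)"
  by (auto simp: ann_def subspace_def inner_add_right)

lemma ann_Un: "ann (F \<union> F') = ann F \<inter> ann F'"
  by (auto simp: ann_def)

lemma ann_empty [simp]: "ann {} = UNIV"
  by (simp add: ann_def)

lemma ann_mono: "F \<subseteq> F' \<Longrightarrow> ann F' \<subseteq> ann F"
  by (auto simp: ann_def)

lemma subspace_colspace: "subspace W \<Longrightarrow> subspace (colspace W)"
  by (auto simp: colspace_def subspace_def column_add column_scaleR)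

lemma colspace_add: "subspace W \<Longrightarrow> \<delta> \<in> colspace W \<Longrightarrow> \<delta>' \<in> colspace W \<Longrightarrow> \<delta> + \<delta>' \<in> colspace W"
  by (simp add: subspace_add subspace_colspace)

lemma colspace_diff: "subspace W \<Longrightarrow> \<delta> \<in> colspace W \<Longrightarrow> \<delta>' \<in> colspace W \<Longrightarrow> \<delta> - \<delta>' \<in> colspace W"
  by (simp add: subspace_diff subspace_colspace)

lemma zero_in_colspace: "subspace W \<Longrightarrow> 0 \<in> colspace W"
  by (simp add: subspace_0 subspace_colspace)

lemma colspace_ann: "\<delta> \<in> colspace (ann F) \<longleftrightarrow> (\<forall>\<alpha>\<in>F. \<forall>j. rvec \<alpha> \<bullet> column j \<delta> = 0)"
  by (auto simp: colspace_def ann_def)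

section \<open>The covering map, characters and flats\<close>

lemma cis_2pi_eq_iff: "cis (2 * pi * s) = cis (2 * pi * t) \<longleftrightarrow> t - s \<in> \<int>"
proof -
  have "cis (2 * pi * s) = cis (2 * pi * t) \<longleftrightarrow> cis (2 * pi * (t - s)) = 1"
    by (simp add: right_diff_distrib flip: cis_divide) (auto simp: eq_commute)
  also have "\<dots> \<longleftrightarrow> t - s \<in> \<int>"
  proof
    assume "cis (2 * pi * (t - s)) = 1"
    then have "cos (2 * pi * (t - s)) = 1"
      by (simp add: complex_eq_iff)
    then obtain n :: int where "2 * pi * (t - s) = of_int n * 2 * pi"
      using cos_one_2pi_int by blast
    then have "t - s = of_int n" by simp
    then show "t - s \<in> \<int>" by simp
  qed simp
  finally show ?thesis .
qed

lemma cover_nth: "cover C \<theta> $ i $ j = (if j \<in> C then cis (2 * pi * \<theta>$i$j) else complex_of_real (\<theta>$i$j))"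
  by (simp add: cover_def)

lemma cover_eq_iff: "cover C \<theta> = cover C \<theta>' \<longleftrightarrow> \<theta>' - \<theta> \<in> periods C"
  by (auto simp: vec_eq_iff cover_nth periods_def cis_2pi_eq_iff)

lemma cover_in_Tset [simp]: "cover C \<theta> \<in> Tset C"
  by (simp add: Tset_def Gset_def cover_nth)

lemma norm_1_eq_cis: "norm z = 1 \<Longrightarrow> cis (Arg z) = z"
  by (metis cis_Arg norm_zero sgn_div_norm div_by_1 inverse_1 scaleR_one zero_neq_one)

text \<open>Arguments of unit complex numbers provide the lifts. From here on, points of T are
  handled through lifts \<theta>.\<close>

lemma Tset_eq_range_cover:
  fixes C :: "'g::finite set"
  shows "(Tset C :: (complex^'g^'l) set) = range (cover C)"
proof
  show "(Tset C :: (complex^'g^'l) set) \<subseteq> range (cover C)"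
  proof
    fix \<phi> :: "complex^'g^'l" assume \<phi>: "\<phi> \<in> Tset C"
    define \<theta> :: "real^'g^'l" where
      "\<theta> = (\<chi> i j. if j \<in> C then Arg (\<phi>$i$j) / (2 * pi) else Re (\<phi>$i$j))"
    have "cover C \<theta> $ i $ j = \<phi> $ i $ j" for i j
      using \<phi> by (auto simp: Tset_def Gset_def cover_nth \<theta>_def norm_1_eq_cis complex_eq_iff)
    then show "\<phi> \<in> range (cover C)"
      by (auto simp: vec_eq_iff image_iff intro!: exI[of _ \<theta>])
  qed
qed auto

lemma inner_rvec_column: "rvec \<alpha> \<bullet> column j \<theta> = (\<Sum>i\<in>UNIV. of_int (\<alpha>$i) * \<theta>$i$j)"
  by (simp add: inner_vec_def rvec_def)

lemma inner_rvec_period: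
  assumes "n \<in> periods C"
  shows "if j \<in> C then rvec \<alpha> \<bullet> column j n \<in> \<int> else rvec \<alpha> \<bullet> column j n = 0"
proof (cases "j \<in> C")
  case True
  then have "n$i$j \<in> \<int>" for i
    using assms by (auto simp: periods_def)
  then show ?thesis
    using True by (auto simp: inner_rvec_column intro!: Ints_sum Ints_mult)
next
  case False
  then show ?thesis
    using assms by (simp add: inner_rvec_column periods_def)
qed

lemma prod_cis: "finite I \<Longrightarrow> (\<Prod>i\<in>I. cis (f i)) = cis (\<Sum>i\<in>I. f i)"
  by (induction I rule: finite_induct) (simp_all add: cis_mult)

text \<open>Upstairs a character becomes a linear form in each coordinate of G: powers and products
  of \<open>cis\<close> add up in the exponent.\<close>

lemma ev_cover_nth:
  "ev C (cover C \<theta>) \<alpha> $ j =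
     (if j \<in> C then cis (2 * pi * (rvec \<alpha> \<bullet> column j \<theta>)) else complex_of_real (rvec \<alpha> \<bullet> column j \<theta>))"
  by (simp add: ev_def cover_nth inner_rvec_column cis_power_int prod_cis sum_distrib_left mult_ac)

lemma ev_cover_eq_iff:
  "ev C (cover C \<theta>) \<alpha> = ev C (cover C \<theta>') \<alpha> \<longleftrightarrow>
     (\<forall>j. if j \<in> C then rvec \<alpha> \<bullet> column j (\<theta>' - \<theta>) \<in> \<int> else rvec \<alpha> \<bullet> column j (\<theta>' - \<theta>) = 0)"
  by (auto simp: vec_eq_iff[where 'b='a] ev_cover_nth cis_2pi_eq_iff column_diff inner_diff_right)

lemma flat_self: "subspace W \<Longrightarrow> cover C \<theta> \<in> flat C \<theta> W"
  using zero_in_colspace by (force simp: flat_def)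

lemma cover_in_flat_iff:
  "cover C \<theta>' \<in> flat C \<theta> W \<longleftrightarrow> (\<exists>\<delta>\<in>colspace W. \<exists>n\<in>periods C. \<theta>' = \<theta> + \<delta> + n)"
proof -
  have "cover C \<theta>' = cover C (\<theta> + \<delta>) \<longleftrightarrow> (\<exists>n\<in>periods C. \<theta>' = \<theta> + \<delta> + n)" for \<delta>
    by (subst eq_commute) (auto simp: cover_eq_iff intro: bexI[of _ "\<theta>' - (\<theta> + \<delta>)"])
  then show ?thesis unfolding flat_def image_iff by simp
qed

text \<open>Flats with the same W are cosets of one subgroup of T, hence equal or disjoint, and any
  lift of any of its points can serve as base point of a flat.\<close>

lemma flat_eqI:
  fixes C :: "'g::finite set" and \<theta> :: "real^'g^'l"
  assumes W: "subspace W" and mem: "cover C \<theta>' \<in> flat C \<theta> W"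
  shows "flat C \<theta>' W = flat C \<theta> W"
proof -
  obtain \<delta> n where \<delta>: "\<delta> \<in> colspace W" and n: "n \<in> periods C" and eq: "\<theta>' = \<theta> + \<delta> + n"
    using mem by (auto simp: cover_in_flat_iff)
  have "cover C (\<theta>' + \<epsilon>) = cover C (\<theta> + (\<delta> + \<epsilon>))" for \<epsilon>
    by (subst eq_commute) (simp add: cover_eq_iff eq n)
  then have eq': "flat C \<theta>' W = (\<lambda>\<epsilon>. cover C (\<theta> + (\<delta> + \<epsilon>))) ` colspace W"
    by (simp add: flat_def)
  have "(\<lambda>\<epsilon>. \<delta> + \<epsilon>) ` colspace W = colspace W"
  proof
    show "colspace W \<subseteq> (\<lambda>\<epsilon>. \<delta> + \<epsilon>) ` colspace W"
    proof
      fix \<epsilon> :: "real^'g^'l" assume "\<epsilon> \<in> colspace W"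
      then show "\<epsilon> \<in> (\<lambda>\<epsilon>. \<delta> + \<epsilon>) ` colspace W"
        using W \<delta> by (intro image_eqI[of _ _ "\<epsilon> - \<delta>"]) (auto intro: colspace_diff)
    qed
  qed (use W \<delta> colspace_add in auto)
  then have "flat C \<theta> W = (\<lambda>\<epsilon>. cover C (\<theta> + \<epsilon>)) ` (\<lambda>\<epsilon>. \<delta> + \<epsilon>) ` colspace W"
    by (simp add: flat_def)
  then show ?thesis
    unfolding eq' by (simp add: image_image)
qed

lemma flat_subset_Tset: "flat C \<theta> W \<subseteq> Tset C"
  by (auto simp: flat_def)

lemma flat_mono: "W \<subseteq> W' \<Longrightarrow> flat C \<theta> W \<subseteq> flat C \<theta> W'"
  by (auto simp: flat_def colspace_def)

lemma flat_UNIV [simp]: "flat C \<theta> UNIV = Tset C"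
proof -
  have "cover C \<theta>' = cover C (\<theta> + (\<theta>' - \<theta>))" for \<theta>' by simp
  then show ?thesis
    unfolding Tset_eq_range_cover flat_def colspace_def by blast
qed

text \<open>Lifts of two points of a flat differ by an element of W^g, which \<alpha> kills, and a
  period, on which \<alpha> is integral in circle coordinates and zero in real ones.\<close>

lemma cover_in_flat_ann_diff:
  assumes "cover C \<theta>' \<in> flat C \<theta> (ann F)" "\<alpha> \<in> F"
  shows "if j \<in> C then rvec \<alpha> \<bullet> column j (\<theta>' - \<theta>) \<in> \<int> else rvec \<alpha> \<bullet> column j (\<theta>' - \<theta>) = 0"
proof -
  obtain \<delta> n where \<delta>: "\<delta> \<in> colspace (ann F)" and n: "n \<in> periods C" and eq: "\<theta>' = \<theta> + \<delta> + n"
    using assms by (auto simp: cover_in_flat_iff)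
  have "rvec \<alpha> \<bullet> column j (\<theta>' - \<theta>) = rvec \<alpha> \<bullet> column j n"
    using \<delta> \<open>\<alpha> \<in> F\<close> by (simp add: eq column_add inner_add_right colspace_ann)
  then show ?thesis using inner_rvec_period[OF n] by simp
qed

lemma continuous_on_cover: "continuous_on S (cover C)"
proof -
  have "continuous_on S (\<lambda>\<theta>. if j \<in> C then cis (2 * pi * \<theta>$i$j) else complex_of_real (\<theta>$i$j))" for i :: 'b and j
    by (cases "j \<in> C") (auto intro!: continuous_intros)
  then show ?thesis
    unfolding cover_def by (intro continuous_on_vec_lambda)
qed

lemma connected_flat: "subspace W \<Longrightarrow> connected (flat C \<theta> W)"
proof -
  assume "subspace W"
  then have "connected (colspace W)"
    by (simp add: convex_connected subspace_colspace subspace_imp_convex)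
  moreover have "continuous_on (colspace W) (\<lambda>\<delta>. cover C (\<theta> + \<delta>))"
    by (rule continuous_on_compose2[OF continuous_on_cover[of UNIV]]) (auto intro!: continuous_intros)
  ultimately show ?thesis
    unfolding flat_def by (rule connected_continuous_image[rotated])
qed

section \<open>Discreteness and connected components\<close>

lemma near_1_imp_small_Arg:
  assumes "\<eta> > 0"
  obtains \<epsilon> where "\<epsilon> > 0" "\<And>z. norm (z - 1) < \<epsilon> \<Longrightarrow> \<bar>Arg z\<bar> < \<eta>"
proof -
  have "isCont Arg 1"
    by (rule continuous_at_Arg) auto
  then obtain \<epsilon> where "\<epsilon> > 0" "\<And>z. dist z 1 < \<epsilon> \<Longrightarrow> dist (Arg z) (Arg 1) < \<eta>"
    using assms unfolding continuous_at_eps_delta by blast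
  then show ?thesis
    using that by (auto simp: dist_norm)
qed

text \<open>Since \<open>cover C\<close> is a homomorphism, lifting near \<theta> reduces to taking
  arguments of numbers near 1. What matters is that \<epsilon> does not depend on \<theta>.\<close>

lemma cover_lift_nearby:
  assumes "\<eta> > 0"
  obtains \<epsilon> where "\<epsilon> > 0"
    "\<And>\<theta> \<psi>. \<psi> \<in> Tset C \<Longrightarrow> dist \<psi> (cover C \<theta>) < \<epsilon> \<Longrightarrow>
       \<exists>\<delta>. cover C (\<theta> + \<delta>) = \<psi> \<and> (\<forall>i j. \<bar>\<delta>$i$j\<bar> < \<eta>)"
proof -
  obtain \<epsilon> where \<epsilon>: "\<epsilon> > 0" "\<And>z. norm (z - 1) < \<epsilon> \<Longrightarrow> \<bar>Arg z\<bar> < \<eta>"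
    using near_1_imp_small_Arg[OF assms] by blast
  show ?thesis
  proof
    \<comment> \<open>\<epsilon> controls the circle coordinates through \<open>Arg\<close>; \<eta>
      itself serves for the real ones, where the displacement is just the difference of
      coordinates.\<close>
    show "min \<epsilon> \<eta> > 0" using \<epsilon> assms by simp
    fix \<theta> :: "real^'a^'b" and \<psi>
    assume \<psi>: "\<psi> \<in> Tset C" and d: "dist \<psi> (cover C \<theta>) < min \<epsilon> \<eta>"
    have dn: "norm (\<psi>$i$j - cover C \<theta>$i$j) < min \<epsilon> \<eta>" for i j
    proof -
      have "norm (\<psi>$i$j - cover C \<theta>$i$j) \<le> norm (\<psi> - cover C \<theta>)"
        by (metis Finite_Cartesian_Product.norm_nth_le order_trans vector_minus_component)
      then show ?thesis using d by (simp add: dist_norm)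
    qed
    define z where "z i j = \<psi>$i$j / cis (2 * pi * \<theta>$i$j)" for i j
    define \<delta> :: "real^'a^'b" where
      "\<delta> = (\<chi> i j. if j \<in> C then Arg (z i j) / (2 * pi) else Re (\<psi>$i$j) - \<theta>$i$j)"
    have z: "norm (z i j) = 1" "\<bar>Arg (z i j)\<bar> < \<eta>" if "j \<in> C" for i j
    proof -
      show "norm (z i j) = 1"
        using \<psi> that by (simp add: z_def norm_divide Tset_def Gset_def)
      have "norm (z i j - 1) = norm ((\<psi>$i$j - cis (2 * pi * \<theta>$i$j)) / cis (2 * pi * \<theta>$i$j))"
        by (simp add: z_def diff_divide_distrib)
      also have "\<dots> < \<epsilon>"
        using dn[of i j] that by (simp add: norm_divide cover_nth)
      finally show "\<bar>Arg (z i j)\<bar> < \<eta>" by (rule \<epsilon>)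
    qed
    have "cover C (\<theta> + \<delta>) $ i $ j = \<psi> $ i $ j" for i j
    proof (cases "j \<in> C")
      case True
      then have "cis (2 * pi * (\<theta> $ i $ j + \<delta> $ i $ j)) = cis (2 * pi * \<theta>$i$j) * z i j"
        by (simp add: \<delta>_def distrib_left z norm_1_eq_cis flip: cis_mult)
      then show ?thesis using True by (simp add: cover_nth z_def)
    next
      case False
      then show ?thesis
        using \<psi> by (simp add: cover_nth \<delta>_def Tset_def Gset_def complex_eq_iff)
    qed
    moreover have "\<bar>\<delta> $ i $ j\<bar> < \<eta>" for i j
    proof (cases "j \<in> C")
      case True
      have "\<bar>Arg (z i j)\<bar> / (2 * pi) \<le> \<bar>Arg (z i j)\<bar> / 1"
        using pi_gt3 by (intro divide_left_mono) auto
      then show ?thesis using z[OF True, of i] True by (simp add: \<delta>_def abs_divide)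
    next
      case False
      then show ?thesis
        using dn[of i j] abs_Re_le_cmod[of "\<psi>$i$j - cover C \<theta>$i$j"]
        by (simp add: \<delta>_def cover_nth)
    qed
    ultimately show "\<exists>\<delta>. cover C (\<theta> + \<delta>) = \<psi> \<and> (\<forall>i j. \<bar>\<delta>$i$j\<bar> < \<eta>)"
      by (auto simp: vec_eq_iff)
  qed
qed

lemma finite_rvec_bound:
  fixes F :: "(int^'l) set"
  assumes "finite F"
  obtains \<eta> where "\<eta> > 0"
    "\<And>\<delta> :: real^'g^'l. \<forall>i j. \<bar>\<delta>$i$j\<bar> < \<eta> \<Longrightarrow> \<forall>\<alpha>\<in>F. \<forall>j. \<bar>rvec \<alpha> \<bullet> column j \<delta>\<bar> < 1"
proof
  \<comment> \<open>M bounds the sum of absolute coefficients of every \<alpha> \<in> F, so the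
    pairings are at most M / (M + 1) < 1; the added one also covers M = 0.\<close>
  define M where "M = (\<Sum>\<alpha>\<in>F. \<Sum>i\<in>UNIV. \<bar>real_of_int (\<alpha>$i)\<bar>)"
  have M: "M \<ge> 0" by (simp add: M_def sum_nonneg)
  show "1 / (M + 1) > 0" using M by simp
  fix \<delta> :: "real^'g^'l" assume \<delta>: "\<forall>i j. \<bar>\<delta>$i$j\<bar> < 1 / (M + 1)"
  show "\<forall>\<alpha>\<in>F. \<forall>j. \<bar>rvec \<alpha> \<bullet> column j \<delta>\<bar> < 1"
  proof (intro ballI allI)
    fix \<alpha> j assume "\<alpha> \<in> F"
    then have le: "(\<Sum>i\<in>UNIV. \<bar>real_of_int (\<alpha>$i)\<bar>) \<le> M"
      unfolding M_def using assms by (intro member_le_sum) (auto intro: sum_nonneg)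
    have "\<bar>rvec \<alpha> \<bullet> column j \<delta>\<bar> \<le> (\<Sum>i\<in>UNIV. \<bar>real_of_int (\<alpha>$i)\<bar> * \<bar>\<delta>$i$j\<bar>)"
      unfolding inner_rvec_column by (rule order_trans[OF sum_abs]) (simp add: abs_mult)
    also have "\<dots> \<le> (\<Sum>i\<in>UNIV. \<bar>real_of_int (\<alpha>$i)\<bar> * (1 / (M + 1)))"
      using \<delta> by (intro sum_mono mult_left_mono) (auto intro: less_imp_le)
    also have "\<dots> \<le> M * (1 / (M + 1))"
      using le M by (simp add: divide_right_mono flip: sum_divide_distrib)
    also have "\<dots> < 1" using M by simp
    finally show "\<bar>rvec \<alpha> \<bullet> column j \<delta>\<bar> < 1" .
  qed
qed

lemma Ints_abs_less_1: "x \<in> \<int> \<Longrightarrow> \<bar>x\<bar> < 1 \<Longrightarrow> x = (0::real)"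
  by (auto elim!: Ints_cases)

text \<open>Both Hyp C \<alpha> c and intersections of its components have this shape. The integrality clause
  makes the flats contained in X uniformly separated, so that they are its connected components.\<close>
definition saturated :: "'g set \<Rightarrow> (int^'l) set \<Rightarrow> (complex^'g^'l) set \<Rightarrow> bool" where
  "saturated C F X \<longleftrightarrow> finite F \<and> X \<subseteq> Tset C \<and>
     (\<forall>\<theta>. cover C \<theta> \<in> X \<longrightarrow> flat C \<theta> (ann F) \<subseteq> X) \<and>
     (\<forall>\<theta> \<theta>'. cover C \<theta> \<in> X \<longrightarrow> cover C \<theta>' \<in> X \<longrightarrow>
        (\<forall>\<alpha>\<in>F. \<forall>j. if j \<in> C then rvec \<alpha> \<bullet> column j (\<theta>' - \<theta>) \<in> \<int> else rvec \<alpha> \<bullet> column j (\<theta>' - \<theta>) = 0))"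

lemma saturatedD:
  assumes "saturated C F X"
  shows "finite F" "X \<subseteq> Tset C" "cover C \<theta> \<in> X \<Longrightarrow> flat C \<theta> (ann F) \<subseteq> X"
    "cover C \<theta> \<in> X \<Longrightarrow> cover C \<theta>' \<in> X \<Longrightarrow> \<alpha> \<in> F \<Longrightarrow> 
      if j \<in> C then rvec \<alpha> \<bullet> column j (\<theta>' - \<theta>) \<in> \<int> else rvec \<alpha> \<bullet> column j (\<theta>' - \<theta>) = 0"
  using assms unfolding saturated_def by blast+

text \<open>An integer of absolute value below 1 is zero. The scale \<eta> is the same for all X and
  \<theta>, so distinct flats in X stay uniformly apart.\<close>

lemma saturated_small:
  fixes C :: "'g::finite set" and F :: "(int^'l) set"
  assumes "finite F"
  obtains \<eta> where "\<eta> > 0"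
    "\<And>X \<theta> \<delta>. saturated C F X \<Longrightarrow> cover C \<theta> \<in> X \<Longrightarrow> cover C (\<theta> + \<delta>) \<in> X \<Longrightarrow>
       \<forall>i j. \<bar>\<delta>$i$j\<bar> < \<eta> \<Longrightarrow> \<delta> \<in> colspace (ann F)"
proof -
  obtain \<eta> where \<eta>: "\<eta> > 0"
    "\<And>\<delta> :: real^'g^'l. \<forall>i j. \<bar>\<delta>$i$j\<bar> < \<eta> \<Longrightarrow> \<forall>\<alpha>\<in>F. \<forall>j. \<bar>rvec \<alpha> \<bullet> column j \<delta>\<bar> < 1"
    using finite_rvec_bound[OF assms] by blast
  show ?thesis
  proof (rule that[OF \<eta>(1)])
    fix X \<theta> and \<delta> :: "real^'g^'l"
    assume X: "saturated C F X" "cover C \<theta> \<in> X" "cover C (\<theta> + \<delta>) \<in> X" and \<delta>: "\<forall>i j. \<bar>\<delta>$i$j\<bar> < \<eta>"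
    show "\<delta> \<in> colspace (ann F)"
      unfolding colspace_ann
    proof (intro ballI allI)
      fix \<alpha> j assume \<alpha>: "\<alpha> \<in> F"
      have "rvec \<alpha> \<bullet> column j \<delta> \<in> \<int>"
        using saturatedD(4)[OF X \<alpha>, of j] by (auto split: if_splits)
      then show "rvec \<alpha> \<bullet> column j \<delta> = 0"
        using \<eta>(2)[OF \<delta>] \<alpha> by (auto intro: Ints_abs_less_1)
    qed
  qed
qed

text \<open>If membership in U does not change at distances below \<epsilon>, then both S \<inter> U
  and its complement in S are open in S.\<close>

lemma clopen_connected_subset:
  fixes S :: "'a::metric_space set"
  assumes "connected S" "x \<in> S" "x \<in> U" "\<epsilon> > 0"
    and "\<And>y z. y \<in> S \<Longrightarrow> z \<in> S \<Longrightarrow> dist y z < \<epsilon> \<Longrightarrow> y \<in> U \<longleftrightarrow> z \<in> U"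
  shows "S \<subseteq> U"
proof -
  have "openin (top_of_set S) (S \<inter> U)" "openin (top_of_set S) (S - S \<inter> U)"
    unfolding openin_euclidean_subtopology_iff using assms(4,5) by blast+
  then have "closedin (top_of_set S) (S \<inter> U)"
    by (simp add: closedin_def)
  then have "S \<inter> U = {} \<or> S \<inter> U = S"
    using assms(1) \<open>openin (top_of_set S) (S \<inter> U)\<close> unfolding connected_clopen by blast
  then show ?thesis using assms(2,3) by blast
qed

text \<open>The flat is connected, which gives one inclusion. For the other, points of X closer than
  \<epsilon> have lifts differing by an element of W^g, so they lie in the same flat and the flat is
  relatively clopen.\<close>

lemma connected_component_saturated:
  fixes C :: "'g::finite set" and X :: "(complex^'g^'l) set"
  assumes X: "saturated C F X" and \<theta>: "cover C \<theta> \<in> X"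
  shows "connected_component_set X (cover C \<theta>) = flat C \<theta> (ann F)" (is "?S = _")
proof
  show "flat C \<theta> (ann F) \<subseteq> ?S"
    using saturatedD(3)[OF X \<theta>]
    by (intro connected_component_maximal) (auto simp: flat_self connected_flat)
  obtain \<eta> where \<eta>: "\<eta> > 0"
    "\<And>X \<theta> \<delta>. saturated C F X \<Longrightarrow> cover C \<theta> \<in> X \<Longrightarrow> cover C (\<theta> + \<delta>) \<in> X \<Longrightarrow>
       \<forall>i j. \<bar>\<delta>$i$j\<bar> < \<eta> \<Longrightarrow> \<delta> \<in> colspace (ann F)"
    using saturated_small[OF saturatedD(1)[OF X], where C=C] by metis
  obtain \<epsilon> where \<epsilon>: "\<epsilon> > 0"
    "\<And>(\<theta> :: real^'g^'l) \<psi>. \<psi> \<in> Tset C \<Longrightarrow> dist \<psi> (cover C \<theta>) < \<epsilon> \<Longrightarrow>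
       \<exists>\<delta>. cover C (\<theta> + \<delta>) = \<psi> \<and> (\<forall>i j. \<bar>\<delta>$i$j\<bar> < \<eta>)"
    using cover_lift_nearby[OF \<eta>(1)] by metis
  have step: "z \<in> flat C \<theta> (ann F)" if asm: "y \<in> ?S" "z \<in> ?S" "dist y z < \<epsilon>" "y \<in> flat C \<theta> (ann F)" for y z
  proof -
    have yz: "y \<in> X" "z \<in> X" using asm(1,2) connected_component_subset by blast+
    then obtain \<theta>' where y: "y = cover C \<theta>'"
      using saturatedD(2)[OF X] Tset_eq_range_cover by blast
    obtain \<delta> where \<delta>: "cover C (\<theta>' + \<delta>) = z" "\<forall>i j. \<bar>\<delta>$i$j\<bar> < \<eta>"
      using \<epsilon>(2)[of z \<theta>'] yz(2) asm(3) saturatedD(2)[OF X] unfolding y by (metis dist_commute in_mono)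
    then have "\<delta> \<in> colspace (ann F)"
      using \<eta>(2)[OF X, of \<theta>' \<delta>] yz y by simp
    then have "z \<in> flat C \<theta>' (ann F)" using \<delta>(1) by (auto simp: flat_def)
    then show ?thesis using flat_eqI asm(4) y by (metis subspace_ann)
  qed
  show "?S \<subseteq> flat C \<theta> (ann F)"
  proof (rule clopen_connected_subset[of _ "cover C \<theta>" _ \<epsilon>])
    fix y z assume "y \<in> ?S" "z \<in> ?S" "dist y z < \<epsilon>"
    then show "y \<in> flat C \<theta> (ann F) \<longleftrightarrow> z \<in> flat C \<theta> (ann F)"
      using step[of y z] step[of z y] by (metis dist_commute)
  qed (use \<theta> \<epsilon>(1) in \<open>auto simp: flat_self\<close>)
qed

lemma components_saturated:
  assumes "saturated C F X"
  shows "components X = {flat C \<theta> (ann F) | \<theta>. cover C \<theta> \<in> X}"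
proof -
  have "components X = {connected_component_set X (cover C \<theta>) | \<theta>. cover C \<theta> \<in> X}"
    using saturatedD(2)[OF assms] unfolding components_def Tset_eq_range_cover by blast
  also have "\<dots> = {flat C \<theta> (ann F) | \<theta>. cover C \<theta> \<in> X}"
    using connected_component_saturated[OF assms] by blast
  finally show ?thesis .
qed

text \<open>Each component has a lift of one of its points in a bounded set R. Infinitely many such
  lifts would accumulate, and two lifts closer than \<eta> lie over the same flat.\<close>

lemma finite_components_saturated:
  fixes C :: "'g::finite set" and X :: "(complex^'g^'l) set"
  assumes X: "saturated C F X"
  shows "finite (components X)"
proof (rule ccontr)
  assume inf: "infinite (components X)"
  obtain \<eta> where \<eta>: "\<eta> > 0"
    "\<And>X \<theta> \<delta>. saturated C F X \<Longrightarrow> cover C \<theta> \<in> X \<Longrightarrow> cover C (\<theta> + \<delta>) \<in> X \<Longrightarrow>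
       \<forall>i j. \<bar>\<delta>$i$j\<bar> < \<eta> \<Longrightarrow> \<delta> \<in> colspace (ann F)"
    using saturated_small[OF saturatedD(1)[OF X], where C=C] by metis
  obtain \<theta>0 where \<theta>0: "cover C \<theta>0 \<in> X"
    using inf by (force simp: components_saturated[OF X])
  \<comment> \<open>Circle coordinates can be reduced by integers. In a real coordinate, the columns
    of two lifts of points of X differ by an element of W, so moving along W^g turns that column
    into the one of \<theta>0.\<close>
  define R where "R = {\<theta>. cover C \<theta> \<in> X \<and> (\<forall>i j. if j \<in> C then \<bar>\<theta>$i$j\<bar> \<le> 1 else \<theta>$i$j = \<theta>0$i$j)}"
  have rep: "\<exists>\<theta>'\<in>R. flat C \<theta>' (ann F) = flat C \<theta> (ann F)" if \<theta>: "cover C \<theta> \<in> X" for \<theta>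
  proof -
    define w :: "real^'g^'l" where "w = (\<chi> i j. if j \<in> C then 0 else \<theta>0$i$j - \<theta>$i$j)"
    define n :: "real^'g^'l" where "n = (\<chi> i j. if j \<in> C then - of_int \<lfloor>\<theta>$i$j\<rfloor> else 0)"
    have col: "column j w = (if j \<in> C then 0 else column j (\<theta>0 - \<theta>))" for j
      by (simp add: vec_eq_iff w_def)
    have w: "w \<in> colspace (ann F)"
      using saturatedD(4)[OF X \<theta> \<theta>0] by (auto simp: colspace_ann col)
    have n: "n \<in> periods C" by (simp add: periods_def n_def)
    have mem: "cover C (\<theta> + w + n) \<in> flat C \<theta> (ann F)"
      using w n unfolding cover_in_flat_iff by blast
    moreover have "\<theta> + w + n \<in> R"
      using mem saturatedD(3)[OF X \<theta>]
      by (auto simp: R_def w_def n_def) (smt (verit) of_int_floor_le real_of_int_floor_add_one_gt)+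
    ultimately show ?thesis
      using flat_eqI[OF subspace_ann mem] by blast
  qed
  have eq: "components X = (\<lambda>\<theta>. flat C \<theta> (ann F)) ` R"
  proof
    show "components X \<subseteq> (\<lambda>\<theta>. flat C \<theta> (ann F)) ` R"
      unfolding components_saturated[OF X] using rep by (smt (verit) imageI mem_Collect_eq subsetI)
  qed (auto simp: components_saturated[OF X] R_def)
  \<comment> \<open>One representative per component, so that distinct points of S lie over distinct
    flats.\<close>
  obtain S where S: "S \<subseteq> R" "inj_on (\<lambda>\<theta>. flat C \<theta> (ann F)) S"
      "components X = (\<lambda>\<theta>. flat C \<theta> (ann F)) ` S"
    using subset_image_inj[of "components X" "\<lambda>\<theta>. flat C \<theta> (ann F)" R] eq by auto
  have "infinite S" using S inf by auto
  moreover have "bounded S"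
  proof -
    have "norm \<theta> \<le> (\<Sum>i\<in>UNIV. \<Sum>j\<in>UNIV. max 1 \<bar>\<theta>0$i$j\<bar>)" if "\<theta> \<in> S" for \<theta>
    proof -
      have "norm \<theta> \<le> (\<Sum>i\<in>UNIV. norm (\<theta>$i))"
        by (simp add: norm_vec_def L2_set_le_sum)
      also have "\<dots> \<le> (\<Sum>i\<in>UNIV. \<Sum>j\<in>UNIV. \<bar>\<theta>$i$j\<bar>)"
        by (intro sum_mono norm_le_l1_cart)
      also have "\<dots> \<le> (\<Sum>i\<in>UNIV. \<Sum>j\<in>UNIV. max 1 \<bar>\<theta>0$i$j\<bar>)"
      proof (intro sum_mono)
        fix i j
        have "if j \<in> C then \<bar>\<theta>$i$j\<bar> \<le> 1 else \<theta>$i$j = \<theta>0$i$j"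
          using that S(1) unfolding R_def by blast
        then show "\<bar>\<theta>$i$j\<bar> \<le> max 1 \<bar>\<theta>0$i$j\<bar>"
          by (auto split: if_splits)
      qed
      finally show ?thesis .
    qed
    then show ?thesis unfolding bounded_iff by blast
  qed
  ultimately obtain l where "l islimpt S"
    using bounded_infinite_imp_islimpt by blast
  then have l: "infinite (S \<inter> ball l (\<eta>/2))"
    using \<eta>(1) by (simp add: islimpt_eq_infinite_ball)
  then obtain \<theta> where \<theta>: "\<theta> \<in> S \<inter> ball l (\<eta>/2)"
    by (metis finite.emptyI ex_in_conv)
  have "infinite (S \<inter> ball l (\<eta>/2) - {\<theta>})" using l by simp
  then obtain \<theta>' where \<theta>': "\<theta>' \<in> S \<inter> ball l (\<eta>/2)" "\<theta>' \<noteq> \<theta>"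
    by (metis finite.emptyI ex_in_conv DiffE singletonI)
  define \<delta> where "\<delta> = \<theta>' - \<theta>"
  have "dist \<theta> \<theta>' < \<eta>"
    using \<theta> \<theta>' by (metis IntE dist_commute dist_triangle_half_r mem_ball)
  then have "norm \<delta> < \<eta>" by (simp add: \<delta>_def dist_norm norm_minus_commute)
  then have "\<forall>i j. \<bar>\<delta>$i$j\<bar> < \<eta>"
    by (metis Finite_Cartesian_Product.norm_nth_le order_le_less_trans real_norm_def)
  moreover have "\<theta> \<in> R" "\<theta>' \<in> R" using \<theta> \<theta>' S(1) by auto
  ultimately have "\<delta> \<in> colspace (ann F)"
    using \<eta>(2)[OF X, of \<theta> \<delta>] by (auto simp: \<delta>_def R_def)
  then have "cover C \<theta>' \<in> flat C \<theta> (ann F)"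
    by (auto simp: flat_def \<delta>_def image_iff intro!: bexI[of _ "\<theta>' - \<theta>"])
  then have "flat C \<theta>' (ann F) = flat C \<theta> (ann F)"
    by (simp add: flat_eqI)
  then show False
    using S(2) \<theta> \<theta>' by (auto dest: inj_onD)
qed

lemma saturated_Hyp: "saturated C {\<alpha>} (Hyp C \<alpha> c)"
proof -
  have flat: "flat C \<theta> (ann {\<alpha>}) \<subseteq> Hyp C \<alpha> c" if "cover C \<theta> \<in> Hyp C \<alpha> c" for \<theta>
  proof -
    have "ev C (cover C \<theta>) \<alpha> = ev C (cover C (\<theta> + \<delta>)) \<alpha>" if "\<delta> \<in> colspace (ann {\<alpha>})" for \<delta>
      using that by (simp add: ev_cover_eq_iff colspace_ann)
    then show ?thesis using that by (auto simp: flat_def Hyp_def)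
  qed
  have "ev C (cover C \<theta>) \<alpha> = ev C (cover C \<theta>') \<alpha>"
    if "cover C \<theta> \<in> Hyp C \<alpha> c" "cover C \<theta>' \<in> Hyp C \<alpha> c" for \<theta> \<theta>'
    using that by (simp add: Hyp_def)
  then show ?thesis
    using flat unfolding saturated_def ev_cover_eq_iff by (auto simp: Hyp_def)
qed

lemma component_Hyp:
  assumes "H \<in> components (Hyp C \<alpha> c)"
  obtains \<theta> where "H = flat C \<theta> (ann {\<alpha>})"
  using assms by (auto simp: components_saturated[OF saturated_Hyp])

text \<open>Every member of B through \<open>cover C \<theta>\<close> is the flat based at \<theta>
  with its own subspace, so the intersection is invariant under the common part of these
  subspaces.\<close>

lemma saturated_Inter:
  assumes "finite B" "\<And>H. H \<in> B \<Longrightarrow> \<exists>\<theta>. H = flat C \<theta> (ann {\<alpha> H})"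
  shows "saturated C (\<alpha> ` B) (Tset C \<inter> \<Inter>B)"
proof -
  have H: "H = flat C \<theta> (ann {\<alpha> H})" if "cover C \<theta> \<in> H" "H \<in> B" for H \<theta>
    using assms(2)[OF that(2)] that flat_eqI by (metis subspace_ann)
  show ?thesis
    unfolding saturated_def
  proof (intro conjI allI impI ballI)
    fix \<theta> assume "cover C \<theta> \<in> Tset C \<inter> \<Inter>B"
    then have "flat C \<theta> (ann (\<alpha> ` B)) \<subseteq> H" if "H \<in> B" for H
      using H[of \<theta> H] flat_mono[OF ann_mono[of "{\<alpha> H}" "\<alpha> ` B"]] that by blast
    then show "flat C \<theta> (ann (\<alpha> ` B)) \<subseteq> Tset C \<inter> \<Inter>B"
      using flat_subset_Tset by blast
  next
    fix \<theta> \<theta>' a j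
    assume *: "cover C \<theta> \<in> Tset C \<inter> \<Inter>B" "cover C \<theta>' \<in> Tset C \<inter> \<Inter>B" and "a \<in> \<alpha> ` B"
    then obtain K where K: "K \<in> B" "a = \<alpha> K" by auto
    then have "cover C \<theta>' \<in> flat C \<theta> (ann {a})"
      using H[of \<theta> K] * by blast
    then show "if j \<in> C then rvec a \<bullet> column j (\<theta>' - \<theta>) \<in> \<int> else rvec a \<bullet> column j (\<theta>' - \<theta>) = 0"
      by (rule cover_in_flat_ann_diff) simp
  qed (use assms in auto)
qed

section \<open>Linear data recovered from a flat\<close>

definition in_col :: "'g \<Rightarrow> real^'l \<Rightarrow> real^'g^'l" where
  "in_col k v = (\<chi> i j. if j = k then v$i else 0)"

lemma column_in_col: "column j (in_col k v) = (if j = k then v else 0)"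
  by (simp add: in_col_def vec_eq_iff)

lemma linear_in_col: "linear (in_col k)"
  by (rule linearI) (auto simp: in_col_def vec_eq_iff)

text \<open>Every layer is a flat, and this recovers its subspace W from the underlying set alone.\<close>
definition directions :: "'g set \<Rightarrow> (complex^'g^'l) set \<Rightarrow> (real^'l) set" where
  "directions C X = {v. \<forall>\<theta> t k. cover C \<theta> \<in> X \<longrightarrow> cover C (\<theta> + in_col k (t *\<^sub>R v)) \<in> X}"

lemma all_multiples_Ints_imp_0:
  assumes "\<And>t. t * x \<in> \<int>" shows "x = (0::real)"
proof (rule ccontr)
  assume "x \<noteq> 0"
  then have "(1/2::real) \<in> \<int>" using assms[of "1 / (2 * x)"] by simp
  then show False by (auto elim!: Ints_cases)
qed

text \<open>Along the line, the pairing with \<alpha> \<in> F changes by t times \<alpha> \<bullet>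
  v, which must be an integer for every real t; hence \<alpha> \<bullet> v = 0.\<close>

lemma invariant_direction_in_ann:
  assumes "\<And>t. cover C (\<theta> + in_col k (t *\<^sub>R v)) \<in> flat C \<theta>' (ann F)"
  shows "v \<in> ann F"
proof -
  have fl: "flat C \<theta> (ann F) = flat C \<theta>' (ann F)"
    using assms[of 0] by (intro flat_eqI) (auto simp: linear_0[OF linear_in_col])
  have "t * (rvec \<alpha> \<bullet> v) \<in> \<int>" if "\<alpha> \<in> F" for \<alpha> t
    using cover_in_flat_ann_diff[OF assms[of t, folded fl] that, of k]
    by (auto simp: column_in_col split: if_splits)
  then show ?thesis
    using all_multiples_Ints_imp_0 by (auto simp: ann_def)
qed

lemma directions_flat [simp]: "directions C (flat C \<theta> (ann F)) = ann F"
proof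
  show "directions C (flat C \<theta> (ann F)) \<subseteq> ann F"
    unfolding directions_def using flat_self[OF subspace_ann] invariant_direction_in_ann by blast
  show "ann F \<subseteq> directions C (flat C \<theta> (ann F))"
  proof -
    have "cover C (\<theta>' + in_col k (t *\<^sub>R v)) \<in> flat C \<theta> (ann F)"
      if "v \<in> ann F" "cover C \<theta>' \<in> flat C \<theta> (ann F)" for v \<theta>' k t
    proof -
      have "in_col k (t *\<^sub>R v) \<in> colspace (ann F)"
        using that(1) by (auto simp: colspace_def column_in_col subspace_mul subspace_0)
      then have "cover C (\<theta>' + in_col k (t *\<^sub>R v)) \<in> flat C \<theta>' (ann F)"
        by (auto simp: flat_def)
      then show ?thesis using flat_eqI[OF subspace_ann that(2)] by simp
    qed
    then show ?thesis by (auto simp: directions_def)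
  qed
qed

lemma flat_subset_iff:
  "flat C \<theta> (ann F) \<subseteq> flat C \<theta> (ann F') \<longleftrightarrow> ann F \<subseteq> ann F'"
proof
  assume sub: "flat C \<theta> (ann F) \<subseteq> flat C \<theta> (ann F')"
  show "ann F \<subseteq> ann F'"
  proof
    fix v assume "v \<in> ann F"
    then have "cover C (\<theta> + in_col k (t *\<^sub>R v)) \<in> flat C \<theta> (ann F)" for k t
      using directions_flat[of C \<theta> F] flat_self[OF subspace_ann, of C \<theta> F] unfolding directions_def by blast
    then show "v \<in> ann F'"
      using sub invariant_direction_in_ann by blast
  qed
qed (rule flat_mono)

text \<open>Choose v in the first subspace with \<alpha> \<bullet> v \<noteq> 0 and slide along v
  separately in each coordinate j of G; the amount s j solves the equation of the hyperplane
  exactly, already upstairs.\<close>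

lemma flats_intersect:
  assumes "\<not> ann F \<subseteq> ann {\<alpha>}"
  shows "flat C \<theta> (ann F) \<inter> flat C \<theta>' (ann {\<alpha>}) \<noteq> {}"
proof -
  obtain v where v: "v \<in> ann F" "rvec \<alpha> \<bullet> v \<noteq> 0"
    using assms by (auto simp: ann_def)
  define s where "s j = (rvec \<alpha> \<bullet> column j (\<theta>' - \<theta>)) / (rvec \<alpha> \<bullet> v)" for j
  define \<delta> where "\<delta> = (\<chi> i j. s j * v$i)"
  have col: "column j \<delta> = s j *\<^sub>R v" for j by (simp add: \<delta>_def vec_eq_iff)
  have "\<delta> \<in> colspace (ann F)"
    by (auto simp: colspace_def col v subspace_mul)
  moreover have "\<theta> + \<delta> - \<theta>' \<in> colspace (ann {\<alpha>})"
    using v by (simp add: colspace_ann column_add column_diff col inner_add_right inner_diff_right s_def)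
  then have "cover C (\<theta> + \<delta>) \<in> flat C \<theta>' (ann {\<alpha>})"
    unfolding flat_def by (rule rev_image_eqI) simp
  ultimately show ?thesis by (auto simp: flat_def)
qed

lemma rvec_eq_0_iff: "rvec \<alpha> = 0 \<longleftrightarrow> \<alpha> = 0"
  by (simp add: rvec_def vec_eq_iff)

section \<open>Dimensions and ranks\<close>

lemma dim_Int_ann_singleton:
  assumes "\<not> ann F \<subseteq> ann {\<alpha>}"
  shows "Suc (dim (ann F \<inter> ann {\<alpha>})) = dim (ann F :: (real^'l) set)"
proof -
  let ?S = "ann F" and ?T = "ann {\<alpha>}" and ?U = "{x + y |x y. x \<in> ann F \<and> y \<in> ann {\<alpha>}}"
  have T: "?T = {x. rvec \<alpha> \<bullet> x = 0}" by (simp add: ann_def)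
  have "\<alpha> \<noteq> 0"
  proof
    assume "\<alpha> = 0"
    then have "rvec \<alpha> = 0" by (simp add: rvec_eq_0_iff)
    then show False using assms unfolding T by simp
  qed
  then have dT: "dim ?T = CARD('l) - 1"
    unfolding T by (subst dim_hyperplane) (auto simp: rvec_eq_0_iff)
  have sub: "subspace ?U" by (rule subspace_sums) auto
  have "?T \<subseteq> ?U" 
  proof
    fix x assume "x \<in> ?T"
    then show "x \<in> ?U" using subspace_0[OF subspace_ann[of F]] by (intro CollectI exI[of _ 0] exI[of _ x]) auto
  qed
  moreover have "?S \<subseteq> ?U" 
  proof
    fix x assume "x \<in> ?S"
    then show "x \<in> ?U" using subspace_0[OF subspace_ann[of "{\<alpha>}"]] by (intro CollectI exI[of _ x] exI[of _ 0]) auto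
  qed
  \<comment> \<open>The kernel of \<alpha> has codimension one, so a strictly larger sum is the
    whole space, and the dimension formula gives the claim.\<close>
  ultimately have "?T \<subset> ?U" using assms by blast
  then have "dim ?T < dim ?U"
    by (intro dim_psubset)
       (simp only: span_eq_iff[THEN iffD2, OF sub] span_eq_iff[THEN iffD2, OF subspace_ann[of "{\<alpha>}"]])
  moreover have "dim ?U \<le> CARD('l)" using dim_subset_UNIV[of ?U] by simp
  moreover have "dim ?U + dim (?S \<inter> ?T) = dim ?S + dim ?T"
    by (rule dim_sums_Int) auto
  ultimately show ?thesis using dT by auto
qed

lemma dim_colspace:
  fixes W :: "(real^'l) set"
  assumes W: "subspace W"
  shows "dim (colspace W :: (real^'g^'l) set) = CARD('g) * dim W"
proof -
  \<comment> \<open>Interpolates between 0 and W^g: each new index in J adds a complementary copy of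
    W.\<close>
  define E where "E J = {\<delta> :: real^'g^'l. \<forall>j. if j \<in> J then column j \<delta> \<in> W else column j \<delta> = 0}" for J
  have subE: "subspace (E J)" for J
    using W by (auto simp: E_def subspace_def column_add column_scaleR)
  have "dim (E J) = card J * dim W" if "finite J" for J
    using that
  proof (induction J rule: finite_induct)
    case empty
    have "E {} = {0}" by (auto simp: E_def vec_eq_iff)
    then show ?case by simp
  next
    case (insert k J)
    have "inj (in_col k)"
      by (rule injI) (metis column_in_col)
    then have d: "dim (in_col k ` W) = dim W"
      using dim_image_eq[OF linear_in_col] by (metis inj_on_subset subset_UNIV)
    have sub: "subspace (in_col k ` W)"
      using W linear_in_col linear_subspace_image by blast
    have "E (insert k J) = {x + y |x y. x \<in> E J \<and> y \<in> in_col k ` W}"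
    proof (intro set_eqI iffI)
      fix \<delta> assume \<delta>: "\<delta> \<in> E (insert k J)"
      have "\<delta> - in_col k (column k \<delta>) \<in> E J" "column k \<delta> \<in> W"
        using \<delta> insert.hyps by (auto simp: E_def column_diff column_in_col split: if_splits)
      then show "\<delta> \<in> {x + y |x y. x \<in> E J \<and> y \<in> in_col k ` W}"
        by (metis (mono_tags, lifting) diff_add_cancel image_eqI mem_Collect_eq)
    next
      fix \<delta> assume "\<delta> \<in> {x + y |x y. x \<in> E J \<and> y \<in> in_col k ` W}"
      then obtain x v where "x \<in> E J" "v \<in> W" "\<delta> = x + in_col k v" by auto
      then show "\<delta> \<in> E (insert k J)"
        using insert.hyps W by (auto simp: E_def column_add column_in_col split: if_splits)
    qed
    moreover have "E J \<inter> in_col k ` W = {0}"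
    proof -
      have "x = 0" if "x \<in> E J" "x = in_col k v" for x v
        using that insert.hyps by (auto simp: E_def column_in_col linear_0[OF linear_in_col] split: if_splits)
      then show ?thesis using subspace_0[OF subE] subspace_0[OF sub] by auto
    qed
    ultimately show ?case
      using dim_sums_Int[OF subE[of J] sub] insert d by simp
  qed
  moreover have "E UNIV = colspace W" by (auto simp: E_def colspace_def)
  ultimately show ?thesis by (metis finite)
qed

text \<open>The preimage of the flat is a union of translates of \<theta>0 + W^g by periods. The
  scale of \<open>saturated_small\<close>, now used upstairs, separates distinct ones, so the
  component through \<theta>0 is the affine space \<theta>0 + W^g.\<close>

lemma dimT_flat:
  fixes C :: "'g::finite set" and F :: "(int^'l) set"
  assumes "finite F"
  shows "dimT C (flat C \<theta> (ann F)) = int (CARD('g) * dim (ann F))"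
proof -
  let ?X = "flat C \<theta> (ann F)"
  \<comment> \<open>The base point that \<open>dimT\<close> picks; the flat is rebased
    there.\<close>
  define \<theta>0 where "\<theta>0 = (SOME \<theta>'. cover C \<theta>' \<in> ?X)"
  have \<theta>0: "cover C \<theta>0 \<in> ?X"
    unfolding \<theta>0_def by (rule someI[of _ \<theta>]) (simp add: flat_self)
  have X: "?X = flat C \<theta>0 (ann F)" using flat_eqI[OF subspace_ann \<theta>0] by simp
  have sat: "saturated C F ?X"
    unfolding saturated_def
  proof (intro conjI allI impI ballI)
    fix \<theta>1 \<theta>2 \<alpha> j
    assume "cover C \<theta>1 \<in> ?X" "cover C \<theta>2 \<in> ?X" "\<alpha> \<in> F"
    then show "if j \<in> C then rvec \<alpha> \<bullet> column j (\<theta>2 - \<theta>1) \<in> \<int> else rvec \<alpha> \<bullet> column j (\<theta>2 - \<theta>1) = 0"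
      using cover_in_flat_ann_diff flat_eqI by (metis subspace_ann)
  qed (use assms flat_subset_Tset in \<open>auto dest: flat_eqI[OF subspace_ann]\<close>)
  obtain \<eta> where \<eta>: "\<eta> > 0"
    "\<And>X \<theta> \<delta>. saturated C F X \<Longrightarrow> cover C \<theta> \<in> X \<Longrightarrow> cover C (\<theta> + \<delta>) \<in> X \<Longrightarrow>
       \<forall>i j. \<bar>\<delta>$i$j\<bar> < \<eta> \<Longrightarrow> \<delta> \<in> colspace (ann F)"
    using saturated_small[OF assms, where C=C] by metis
  let ?S = "connected_component_set (cover C -` ?X) \<theta>0"
  let ?E = "(+) \<theta>0 ` colspace (ann F)"
  have self: "\<theta>0 \<in> ?E" by (intro image_eqI[of _ _ 0]) (auto intro: zero_in_colspace)
  have "cover C \<theta>' \<in> ?X" if "\<theta>' \<in> ?E" for \<theta>'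
  proof -
    have "cover C \<theta>' \<in> flat C \<theta>0 (ann F)" using that by (auto simp: flat_def)
    then show ?thesis using X by simp
  qed
  then have E: "?E \<subseteq> cover C -` ?X" by blast
  have "?S = ?E"
  proof
    have "connected ?E"
      by (intro convex_connected convex_translation subspace_imp_convex subspace_colspace) simp
    then show "?E \<subseteq> ?S"
      using self E by (intro connected_component_maximal)
    have step: "z \<in> ?E" if "y \<in> ?S" "z \<in> ?S" "dist y z < \<eta>" "y \<in> ?E" for y z
    proof -
      have yz: "cover C y \<in> ?X" "cover C z \<in> ?X" using that(1,2) connected_component_subset by blast+
      have "norm (z - y) < \<eta>" using that(3) by (simp add: dist_norm norm_minus_commute)
      then have "\<forall>i j. \<bar>(z - y)$i$j\<bar> < \<eta>"
        by (metis Finite_Cartesian_Product.norm_nth_le order_le_less_trans real_norm_def)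
      then have "z - y \<in> colspace (ann F)"
        using \<eta>(2)[OF sat, of y "z - y"] yz by simp
      moreover have "y - \<theta>0 \<in> colspace (ann F)" using that(4) by auto
      ultimately have "(z - y) + (y - \<theta>0) \<in> colspace (ann F)"
        by (intro colspace_add) auto
      then show ?thesis by (intro image_eqI[of _ _ "z - \<theta>0"]) auto
    qed
    show "?S \<subseteq> ?E"
    proof (rule clopen_connected_subset[of _ "\<theta>0" _ \<eta>])
      fix y z assume "y \<in> ?S" "z \<in> ?S" "dist y z < \<eta>"
      then show "y \<in> ?E \<longleftrightarrow> z \<in> ?E"
        using step[of y z] step[of z y] by (metis dist_commute)
    qed (use \<theta>0 \<eta>(1) self in auto)
  qed
  then have "dimT C ?X = aff_dim ?E" by (simp add: dimT_def \<theta>0_def)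
  also have "\<dots> = int (dim (colspace (ann F) :: (real^'g^'l) set))"
    by (simp add: aff_dim_translation_eq aff_dim_subspace subspace_colspace)
  finally show ?thesis by (simp add: dim_colspace)
qed

text \<open>For a layer this is the codimension of W in R^l, and the codimension of W^g is g times
  as large. It is read off from X alone, so it agrees in all subarrangements.\<close>

definition rk :: "'g set \<Rightarrow> (complex^'g^'l) set \<Rightarrow> nat" where
  "rk C X = CARD('l) - dim (directions C X)"

lemma rankT_flat:
  assumes "finite F"
  shows "rankT C (flat C \<theta> (ann F)) = rk C (flat C \<theta> (ann F))"
proof -
  have "int (CARD('a) * CARD('b)) - int (CARD('b) * dim (ann F)) = int CARD('b) * (int CARD('a) - int (dim (ann F)))"
    by (simp add: algebra_simps)
  then show ?thesis
    by (simp add: rankT_def codimT_def dimT_flat[OF assms] rk_def nat_diff_distrib)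
qed

section \<open>Posets of layers\<close>

text \<open>What is kept of an abelian arrangement. \<open>abelian_arrangement\<close> takes all
  components of each \<open>Hyp C \<alpha> c\<close> together, whereas this form passes to subsets
  at once.\<close>

definition arrangement :: "'g set \<Rightarrow> (complex^'g^'l) set set \<Rightarrow> bool" where
  "arrangement C A \<longleftrightarrow> finite A \<and> (\<forall>H\<in>A. \<exists>\<alpha> \<theta>. \<alpha> \<noteq> 0 \<and> H = flat C \<theta> (ann {\<alpha>}))"

text \<open>Chosen from H alone, so that subarrangements use the same characters. Only the kernel of
  the character matters, and H determines it (\<open>directions_hyperplane\<close>).\<close>

definition normal_vec :: "'g set \<Rightarrow> (complex^'g^'l) set \<Rightarrow> int^'l" where
  "normal_vec C H = (SOME \<alpha>. \<alpha> \<noteq> 0 \<and> (\<exists>\<theta>. H = flat C \<theta> (ann {\<alpha>})))"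

abbreviation common_dirs :: "'g set \<Rightarrow> (complex^'g^'l) set set \<Rightarrow> (real^'l) set" where
  "common_dirs C B \<equiv> ann (normal_vec C ` B)"

lemma arrangement_subset: "arrangement C A \<Longrightarrow> B \<subseteq> A \<Longrightarrow> arrangement C B"
  unfolding arrangement_def by (meson finite_subset subset_iff)

lemma abelian_arrangement_imp_arrangement:
  assumes "abelian_arrangement C A"
  shows "arrangement C A"
proof -
  obtain S where S: "finite S" "\<And>\<alpha> c. (\<alpha>, c) \<in> S \<Longrightarrow> \<alpha> \<noteq> 0" "A = (\<Union>(\<alpha>, c)\<in>S. components (Hyp C \<alpha> c))"
    using assms unfolding abelian_arrangement_def by fast
  have "finite A"
    unfolding S(3) using S(1) finite_components_saturated[OF saturated_Hyp] by auto
  moreover have "\<exists>\<alpha> \<theta>. \<alpha> \<noteq> 0 \<and> H = flat C \<theta> (ann {\<alpha>})" if "H \<in> A" for H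
  proof -
    obtain \<alpha> c where "(\<alpha>, c) \<in> S" "H \<in> components (Hyp C \<alpha> c)" using \<open>H \<in> A\<close> S(3) by auto
    then show ?thesis using S(2) component_Hyp by metis
  qed
  ultimately show ?thesis by (simp add: arrangement_def)
qed

lemma normal_vec:
  assumes "arrangement C A" "H \<in> A"
  shows "normal_vec C H \<noteq> 0" "\<exists>\<theta>. H = flat C \<theta> (ann {normal_vec C H})"
proof -
  have "\<exists>\<alpha>. \<alpha> \<noteq> 0 \<and> (\<exists>\<theta>. H = flat C \<theta> (ann {\<alpha>}))"
    using assms unfolding arrangement_def by blast
  then have "normal_vec C H \<noteq> 0 \<and> (\<exists>\<theta>. H = flat C \<theta> (ann {normal_vec C H}))"
    unfolding normal_vec_def by (rule someI_ex)
  then show "normal_vec C H \<noteq> 0" "\<exists>\<theta>. H = flat C \<theta> (ann {normal_vec C H})" by auto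
qed

lemma directions_hyperplane:
  assumes "arrangement C A" "H \<in> A"
  shows "directions C H = ann {normal_vec C H}"
proof -
  obtain \<theta> where "H = flat C \<theta> (ann {normal_vec C H})" using normal_vec(2)[OF assms] ..
  then show ?thesis using directions_flat[of C \<theta> "{normal_vec C H}"] by simp
qed

lemma saturated_arrangement:
  assumes "arrangement C A" "B \<subseteq> A"
  shows "saturated C (normal_vec C ` B) (Tset C \<inter> \<Inter>B)"
proof -
  have B: "arrangement C B" using arrangement_subset assms .
  show ?thesis
    by (rule saturated_Inter) (use B normal_vec(2)[OF B] in \<open>auto simp: arrangement_def\<close>)
qed

section \<open>Layers as flats\<close>

lemma LposE:
  assumes "X \<in> Lpos C A"
  obtains B where "B \<subseteq> A" "X \<in> components (Tset C \<inter> \<Inter>B)"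
  using assms unfolding Lpos_def by blast

lemma LposI:
  assumes "B \<subseteq> A" "X \<in> components (Tset C \<inter> \<Inter>B)"
  shows "X \<in> Lpos C A"
proof -
  have "Tset C \<inter> \<Inter>B \<noteq> {}"
    using in_components_nonempty[OF assms(2)] in_components_subset[OF assms(2)] by (metis subset_empty)
  then show ?thesis unfolding Lpos_def using assms by blast
qed

lemma
  assumes "X \<in> Lpos C A"
  shows Lpos_connected: "connected X"
    and Lpos_nonempty: "X \<noteq> {}"
    and Lpos_subset_Tset: "X \<subseteq> Tset C"
proof -
  obtain B where B: "X \<in> components (Tset C \<inter> \<Inter>B)" using LposE[OF assms] .
  show "connected X" using in_components_connected[OF B] .
  show "X \<noteq> {}" using in_components_nonempty[OF B] .
  show "X \<subseteq> Tset C" using in_components_subset[OF B] by blast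
qed

lemma Lpos_mono: "A \<subseteq> A' \<Longrightarrow> Lpos C A \<subseteq> Lpos C A'"
  unfolding Lpos_def by blast

lemma Lpos_ex_cover:
  assumes "X \<in> Lpos C A"
  shows "\<exists>\<theta>. cover C \<theta> \<in> X"
proof -
  obtain \<phi> where "\<phi> \<in> X" using Lpos_nonempty[OF assms] by blast
  then have "\<phi> \<in> range (cover C)" using Lpos_subset_Tset[OF assms] Tset_eq_range_cover by blast
  then show ?thesis using \<open>\<phi> \<in> X\<close> by auto
qed

lemma flat_in_Lpos:
  assumes "arrangement C A" "B \<subseteq> A" "cover C \<theta> \<in> \<Inter>B"
  shows "flat C \<theta> (common_dirs C B) \<in> Lpos C A"
proof -
  have "flat C \<theta> (common_dirs C B) \<in> components (Tset C \<inter> \<Inter>B)"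
    unfolding components_saturated[OF saturated_arrangement[OF assms(1,2)]] using assms(3) by auto
  then show ?thesis using assms(2) LposI by blast
qed

text \<open>The base point is any lift of a point of X, so several layers through one point can be
  written with the same \<theta>.\<close>

lemma Lpos_flat:
  assumes "arrangement C A" "X \<in> Lpos C A" "cover C \<theta> \<in> X"
  obtains B where "B \<subseteq> A" "X = flat C \<theta> (common_dirs C B)" "X \<subseteq> \<Inter>B"
proof -
  obtain B where B: "B \<subseteq> A" "X \<in> components (Tset C \<inter> \<Inter>B)" using LposE[OF assms(2)] .
  then obtain \<theta>' where "X = flat C \<theta>' (common_dirs C B)"
    unfolding components_saturated[OF saturated_arrangement[OF assms(1) B(1)]] by auto
  then have "X = flat C \<theta> (common_dirs C B)" using flat_eqI[OF subspace_ann, of C \<theta> \<theta>'] assms(3) by simp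
  then show ?thesis using that B(1) in_components_subset[OF B(2)] by blast
qed

lemma Lpos_directions:
  assumes "arrangement C A" "X \<in> Lpos C A"
  obtains B where "B \<subseteq> A" "directions C X = common_dirs C B" "X \<subseteq> \<Inter>B"
proof -
  obtain \<theta> where \<theta>: "cover C \<theta> \<in> X" using Lpos_ex_cover[OF assms(2)] ..
  obtain B where B: "B \<subseteq> A" "X = flat C \<theta> (common_dirs C B)" "X \<subseteq> \<Inter>B" using Lpos_flat[OF assms \<theta>] .
  show ?thesis by (rule that[OF B(1) _ B(3)]) (simp add: B(2))
qed

text \<open>Both layers are flats based at the common \<theta>, so the order becomes inclusion of
  subspaces. This linearization underlies the rank arguments for layers.\<close>

lemma Lpos_subset_iff:
  assumes A: "arrangement C A" and XY: "X \<in> Lpos C A" "Y \<in> Lpos C A" "cover C \<theta> \<in> X" "cover C \<theta> \<in> Y"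
  shows "X \<subseteq> Y \<longleftrightarrow> directions C X \<subseteq> directions C Y"
proof -
  obtain B where B: "X = flat C \<theta> (common_dirs C B)" using Lpos_flat[OF A XY(1,3)] .
  obtain B' where B': "Y = flat C \<theta> (common_dirs C B')" using Lpos_flat[OF A XY(2,4)] .
  show ?thesis unfolding B B' by (simp add: flat_subset_iff)
qed

lemma hyperplane_in_Lpos:
  assumes "arrangement C A" "H \<in> A"
  shows "H \<in> Lpos C A"
proof -
  obtain \<theta> where \<theta>: "H = flat C \<theta> (ann {normal_vec C H})" using normal_vec(2)[OF assms] ..
  then have "cover C \<theta> \<in> \<Inter>{H}" using flat_self[OF subspace_ann] by blast
  from flat_in_Lpos[OF assms(1) _ this] show ?thesis using \<theta> assms(2) by simp
qed

lemma Tset_in_Lpos: "arrangement C A \<Longrightarrow> Tset C \<in> Lpos C A"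
  using flat_in_Lpos[of C A "{}"] by simp

lemma directions_Tset [simp]: "directions C (Tset C) = UNIV"
  using directions_flat[of C 0 "{}"] by simp

text \<open>Y \<inter> Z may have several components, and \<theta> selects one: the layer through
  its image cut out by the hyperplanes used for Y together with those used for Z.\<close>

lemma ex_local_join:
  assumes A: "arrangement C A" and YZ: "Y \<in> Lpos C A" "Z \<in> Lpos C A" "cover C \<theta> \<in> Y" "cover C \<theta> \<in> Z"
  obtains J where "J \<in> Lpos C A" "cover C \<theta> \<in> J" "directions C J = directions C Y \<inter> directions C Z"
    "J \<subseteq> Y" "J \<subseteq> Z"
proof -
  obtain B where B: "B \<subseteq> A" "Y = flat C \<theta> (common_dirs C B)" "Y \<subseteq> \<Inter>B" using Lpos_flat[OF A YZ(1,3)] .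
  obtain B' where B': "B' \<subseteq> A" "Z = flat C \<theta> (common_dirs C B')" "Z \<subseteq> \<Inter>B'" using Lpos_flat[OF A YZ(2,4)] .
  define J where "J = flat C \<theta> (common_dirs C (B \<union> B'))"
  have J: "J \<in> Lpos C A" unfolding J_def
    by (rule flat_in_Lpos[OF A]) (use B B' YZ in auto)
  have \<theta>J: "cover C \<theta> \<in> J" by (simp add: J_def flat_self)
  have dir: "directions C J = directions C Y \<inter> directions C Z"
    unfolding J_def B(2) B'(2) directions_flat by (simp add: image_Un ann_Un)
  show ?thesis
    by (rule that[OF J \<theta>J dir])
       (use Lpos_subset_iff[OF A J YZ(1) \<theta>J YZ(3)] Lpos_subset_iff[OF A J YZ(2) \<theta>J YZ(4)] dir in auto)
qed

text \<open>At a point of K, the local join of Y and Z contains K, and minimality makes them equal.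
  So all minimal upper bounds of Y and Z have the same directions.\<close>

lemma directions_mub:
  assumes A: "arrangement C A" and YZ: "Y \<in> Lpos C A" "Z \<in> Lpos C A" and K: "K \<in> mubs (Lpos C A) revincl {Y, Z}"
  shows "directions C K = directions C Y \<inter> directions C Z"
proof -
  have K': "K \<in> Lpos C A" "K \<subseteq> Y" "K \<subseteq> Z"
    using K by (auto simp: mubs_def ubs_def revincl_def)
  obtain \<theta> where \<theta>: "cover C \<theta> \<in> K" using Lpos_ex_cover[OF K'(1)] ..
  then have \<theta>': "cover C \<theta> \<in> Y" "cover C \<theta> \<in> Z" using K' by auto
  obtain J where J: "J \<in> Lpos C A" "cover C \<theta> \<in> J" "directions C J = directions C Y \<inter> directions C Z"
    "J \<subseteq> Y" "J \<subseteq> Z" using ex_local_join[OF A YZ \<theta>'] .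
  have "directions C K \<subseteq> directions C J"
    unfolding J(3) using K'(2,3) Lpos_subset_iff[OF A K'(1) YZ(1) \<theta> \<theta>'(1)] Lpos_subset_iff[OF A K'(1) YZ(2) \<theta> \<theta>'(2)]
    by blast
  then have "K \<subseteq> J" using Lpos_subset_iff[OF A K'(1) J(1) \<theta> J(2)] by blast
  then have "J = K" using K J(1,4,5) by (auto simp: mubs_def ubs_def revincl_def)
  then show ?thesis using J(3) by simp
qed

lemma finite_Lpos:
  assumes "arrangement C A"
  shows "finite (Lpos C A)"
proof -
  have "Lpos C A \<subseteq> (\<Union>B\<in>Pow A. components (Tset C \<inter> \<Inter>B))"
    by (auto simp: Lpos_def)
  moreover have "finite \<dots>"
    using assms finite_components_saturated[OF saturated_arrangement[OF assms]]
    by (auto simp: arrangement_def)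
  ultimately show ?thesis using finite_subset by blast
qed

lemma subspace_directions:
  assumes "arrangement C A" "X \<in> Lpos C A"
  shows "subspace (directions C X)"
proof -
  obtain B where "directions C X = common_dirs C B" using Lpos_directions[OF assms] .
  then show ?thesis by simp
qed

lemma dim_le_card: "dim (V :: (real^'l) set) \<le> CARD('l)"
  using dim_subset_UNIV[of V] by simp

lemma rk_less_if_directions_psubset:
  fixes X Y :: "(complex^'g^'l) set"
  assumes "subspace (directions C X)" "subspace (directions C Y)" "directions C Y \<subset> directions C X"
  shows "rk C X < rk C Y"
proof -
  have "dim (directions C Y) < dim (directions C X)"
    by (intro dim_psubset)
       (simp only: span_eq_iff[THEN iffD2, OF assms(1)] span_eq_iff[THEN iffD2, OF assms(2)] assms(3))
  then show ?thesis using dim_le_card[of "directions C X"] by (simp add: rk_def)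
qed

text \<open>The axioms on joins, ranks and separation are checked at a lift of a point common to the
  layers involved, where \<open>Lpos_subset_iff\<close> reduces them to linear algebra.\<close>

lemma layer_poset_Lpos:
  fixes C :: "'g::finite set" and A :: "(complex^'g^'l) set set"
  assumes A: "arrangement C A"
  shows "layer_poset (Lpos C A) revincl (rk C) A (Tset C)"
proof
  show "finite (Lpos C A)" using finite_Lpos[OF A] .
  show "Tset C \<in> Lpos C A" using Tset_in_Lpos[OF A] .
  show "revincl (Tset C) X" if "X \<in> Lpos C A" for X
    using Lpos_subset_Tset[OF that] by (simp add: revincl_def)
  show "A \<subseteq> Lpos C A" using hyperplane_in_Lpos[OF A] by blast
  have card: "Suc (dim (common_dirs C B \<inter> directions C H)) = dim (common_dirs C B)"
    if "H \<in> A" "\<not> common_dirs C B \<subseteq> directions C H" for B H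
    using that dim_Int_ann_singleton by (simp add: directions_hyperplane[OF A])
  show "rk C H = 1" if H: "H \<in> A" for H
  proof -
    have "ann {normal_vec C H} = {x. rvec (normal_vec C H) \<bullet> x = 0}" by (simp add: ann_def)
    moreover have "rvec (normal_vec C H) \<noteq> 0" using normal_vec(1)[OF A H] by (simp add: rvec_eq_0_iff)
    ultimately have "dim (directions C H) = CARD('l) - 1"
      unfolding directions_hyperplane[OF A H] by (simp add: dim_hyperplane)
    then show ?thesis by (simp add: rk_def Suc_leI)
  qed
  show "\<exists>J\<in>Lpos C A. revincl Y J \<and> revincl Z J \<and> revincl J X \<and>
      (\<forall>V\<in>Lpos C A. revincl V X \<longrightarrow> revincl Y V \<longrightarrow> revincl Z V \<longrightarrow> revincl J V)"
    if XYZ: "X \<in> Lpos C A" "Y \<in> Lpos C A" "Z \<in> Lpos C A" "revincl Y X" "revincl Z X" for X Y Z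
  proof -
    obtain \<theta> where \<theta>: "cover C \<theta> \<in> X" using Lpos_ex_cover[OF XYZ(1)] ..
    then have \<theta>': "cover C \<theta> \<in> Y" "cover C \<theta> \<in> Z" using XYZ(4,5) by (auto simp: revincl_def)
    obtain J where J: "J \<in> Lpos C A" "cover C \<theta> \<in> J" "directions C J = directions C Y \<inter> directions C Z"
      "J \<subseteq> Y" "J \<subseteq> Z" using ex_local_join[OF A XYZ(2,3) \<theta>'] .
    have least: "V \<subseteq> J" if V: "V \<in> Lpos C A" "X \<subseteq> V" "V \<subseteq> Y" "V \<subseteq> Z" for V
    proof -
      have "cover C \<theta> \<in> V" using V \<theta> by blast
      then show ?thesis
        using V(3,4) J(3) Lpos_subset_iff[OF A V(1) XYZ(2) _ \<theta>'(1)] Lpos_subset_iff[OF A V(1) XYZ(3) _ \<theta>'(2)]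
          Lpos_subset_iff[OF A V(1) J(1) _ J(2)] by simp
    qed
    have "X \<subseteq> J" using least[OF XYZ(1)] XYZ(4,5) by (auto simp: revincl_def)
    then show ?thesis
      using J(4,5) least by (intro bexI[OF _ J(1)]) (simp add: revincl_def)
  qed
  show "rk C X < rk C Y" if XY: "X \<in> Lpos C A" "Y \<in> Lpos C A" "revincl X Y" "X \<noteq> Y" for X Y
  proof -
    obtain \<theta> where \<theta>: "cover C \<theta> \<in> Y" using Lpos_ex_cover[OF XY(2)] ..
    then have \<theta>': "cover C \<theta> \<in> X" using XY(3) by (auto simp: revincl_def)
    have "directions C Y \<subset> directions C X"
      using XY(3,4) Lpos_subset_iff[OF A XY(1,2) \<theta>' \<theta>] Lpos_subset_iff[OF A XY(2,1) \<theta> \<theta>']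
      by (auto simp: revincl_def)
    then show ?thesis
      using rk_less_if_directions_psubset subspace_directions[OF A] XY(1,2) by blast
  qed
  show "rk C J = Suc (rk C Y)"
    if Y: "Y \<in> Lpos C A" and H: "H \<in> A" "\<not> revincl H Y" and J: "J \<in> mubs (Lpos C A) revincl {Y, H}" for Y H J
  proof -
    have HL: "H \<in> Lpos C A" using hyperplane_in_Lpos[OF A H(1)] .
    have J': "J \<in> Lpos C A" "J \<subseteq> Y" "J \<subseteq> H" using J by (auto simp: mubs_def ubs_def revincl_def)
    obtain \<theta> where \<theta>: "cover C \<theta> \<in> J" using Lpos_ex_cover[OF J'(1)] ..
    have "\<not> directions C Y \<subseteq> directions C H"
      using Lpos_subset_iff[OF A Y HL, of \<theta>] \<theta> J' H(2) by (auto simp: revincl_def)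
    moreover obtain B where B: "directions C Y = common_dirs C B" using Lpos_directions[OF A Y] .
    ultimately have "Suc (dim (directions C J)) = dim (directions C Y)"
      using card[OF H(1)] directions_mub[OF A Y HL J] by simp
    then show ?thesis
      using dim_le_card[of "directions C Y"] by (simp add: rk_def)
  qed
  show "\<exists>H\<in>A. revincl H Y \<and> \<not> revincl H X" if XY: "X \<in> Lpos C A" "Y \<in> Lpos C A" "revincl X Y" "X \<noteq> Y" for X Y
  proof (rule ccontr)
    assume no: "\<not> ?thesis"
    obtain \<theta> where \<theta>: "cover C \<theta> \<in> Y" using Lpos_ex_cover[OF XY(2)] ..
    then have \<theta>': "cover C \<theta> \<in> X" using XY(3) by (auto simp: revincl_def)
    obtain B where B: "B \<subseteq> A" "Y = flat C \<theta> (common_dirs C B)" "Y \<subseteq> \<Inter>B"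
      using Lpos_flat[OF A XY(2) \<theta>] .
    \<comment> \<open>If every hyperplane containing Y contained X, the directions of X would
      satisfy all the linear conditions that define Y.\<close>
    have "directions C X \<subseteq> ann {normal_vec C H}" if "H \<in> B" for H
    proof -
      have H: "H \<in> A" "H \<in> Lpos C A" using that B(1) hyperplane_in_Lpos[OF A] by auto
      have "Y \<subseteq> H" using that B(3) by blast
      then have "X \<subseteq> H" using no H(1) by (auto simp: revincl_def)
      then show ?thesis
        using Lpos_subset_iff[OF A XY(1) H(2) \<theta>'] \<theta>' directions_hyperplane[OF A H(1)] by auto
    qed
    then have "directions C X \<subseteq> common_dirs C B" by (auto simp: ann_def)
    then have "X \<subseteq> Y"
      using Lpos_subset_iff[OF A XY(1,2) \<theta>' \<theta>] by (simp add: B(2))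
    then show False using XY(3,4) by (auto simp: revincl_def)
  qed
qed (auto simp: revincl_def rk_def)

lemma rankT_eq_rk:
  assumes "arrangement C A" "X \<in> Lpos C A"
  shows "rankT C X = rk C X"
proof -
  obtain \<theta> where "cover C \<theta> \<in> X" using Lpos_ex_cover[OF assms(2)] ..
  then obtain B where B: "B \<subseteq> A" "X = flat C \<theta> (common_dirs C B)" using Lpos_flat[OF assms] by metis
  have "finite (normal_vec C ` B)" using B(1) assms(1) finite_subset by (auto simp: arrangement_def)
  then show ?thesis unfolding B(2) by (rule rankT_flat)
qed

lemma poset_rank_Lpos:
  assumes A: "arrangement C A"
  shows "poset_rank (Lpos C A) revincl = arr_rank C A"
  unfolding layer_poset.poset_rank_eq[OF layer_poset_Lpos[OF A]] arr_rank_def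
  using rankT_eq_rk[OF A] by (simp cong: image_cong_simp)

section \<open>Components as minimal upper bounds\<close>

lemma component_mub:
  assumes "B \<subseteq> A" "X \<in> components (Tset C \<inter> \<Inter>B)"
  shows "X \<in> mubs (Lpos C A) revincl B"
proof -
  have "W = X" if W: "W \<in> Lpos C A" "\<forall>H\<in>B. W \<subseteq> H" "X \<subseteq> W" for W
  proof -
    have "W \<subseteq> X"
      using assms(2) W Lpos_connected[OF W(1)] Lpos_subset_Tset[OF W(1)] in_components_nonempty[OF assms(2)]
      by (intro components_maximal[OF assms(2)]) auto
    then show ?thesis using W(3) by blast
  qed
  then show ?thesis
    using LposI[OF assms] in_components_subset[OF assms(2)] by (auto simp: mubs_def ubs_def revincl_def)
qed

text \<open>Add H to the hyperplanes that cut out X. A connected subset of the new intersection that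
  meets X stays in X, so K is also a component of that intersection.\<close>

lemma component_Int_in_Lpos:
  assumes X: "X \<in> Lpos C A" and H: "H \<in> A" and K: "K \<in> components (X \<inter> H)"
  shows "K \<in> Lpos C A"
proof -
  obtain B where B: "B \<subseteq> A" "X \<in> components (Tset C \<inter> \<Inter>B)" using LposE[OF X] .
  have Kc: "connected K" "K \<noteq> {}" "K \<subseteq> X \<inter> H"
    using K in_components_connected in_components_nonempty in_components_subset by blast+
  have sub: "K \<subseteq> Tset C \<inter> \<Inter>(insert H B)" using Kc(3) in_components_subset[OF B(2)] by auto
  then obtain K' where K': "K' \<in> components (Tset C \<inter> \<Inter>(insert H B))" "K \<subseteq> K'"
    using exists_component_superset[OF sub _ Kc(1)] Kc(2) by blast
  have c': "connected K'" "K' \<subseteq> Tset C \<inter> \<Inter>(insert H B)"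
    using K'(1) in_components_connected in_components_subset by blast+
  have "K' \<subseteq> X"
    by (rule components_maximal[OF B(2) c'(1)]) (use c'(2) Kc K'(2) in auto)
  then have "K' \<subseteq> K"
    by (intro components_maximal[OF K c'(1)]) (use c'(2) Kc K'(2) in auto)
  then have "K = K'" using K'(2) by blast
  then show ?thesis using LposI[OF _ K'(1)] B(1) H by auto
qed

text \<open>The dictionary between topology and order: minimal upper bounds are the largest layers
  inside X \<inter> H, layers are connected, and components of X \<inter> H are layers.\<close>

lemma components_Int_eq_mubs:
  assumes X: "X \<in> Lpos C A" and H: "H \<in> A"
  shows "components (X \<inter> H) = mubs (Lpos C A) revincl {X, H}"
proof (intro set_eqI iffI)
  fix K assume K: "K \<in> components (X \<inter> H)"
  have "W = K" if W: "W \<in> Lpos C A" "W \<subseteq> X" "W \<subseteq> H" "K \<subseteq> W" for W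
    using components_maximal[OF K Lpos_connected[OF W(1)]] W in_components_nonempty[OF K] by blast
  then show "K \<in> mubs (Lpos C A) revincl {X, H}"
    using component_Int_in_Lpos[OF X H K] in_components_subset[OF K]
    by (auto simp: mubs_def ubs_def revincl_def)
next
  fix K assume K: "K \<in> mubs (Lpos C A) revincl {X, H}"
  then have K': "K \<in> Lpos C A" "K \<subseteq> X \<inter> H" by (auto simp: mubs_def ubs_def revincl_def)
  then obtain W where W: "W \<in> components (X \<inter> H)" "K \<subseteq> W"
    using exists_component_superset[OF K'(2) _ Lpos_connected] Lpos_nonempty[OF K'(1)] by blast
  have "W = K"
    using K W component_Int_in_Lpos[OF X H W(1)] in_components_subset[OF W(1)]
    by (auto simp: mubs_def ubs_def revincl_def)
  then show "K \<in> components (X \<inter> H)" using W(1) by simp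
qed

text \<open>Collect the hyperplanes of B that cut out the members of S. The component W of their
  intersection around Z is an upper bound of S in L(B), and minimality of Z gives W = Z.\<close>

lemma join_closed_Lpos:
  assumes "B \<subseteq> A"
  shows "join_closed (Lpos C A) revincl (Lpos C B)"
  unfolding join_closed_def
proof (intro allI impI subsetI)
  fix S Z assume S: "S \<subseteq> Lpos C B" and Z: "Z \<in> mubs (Lpos C A) revincl S"
  have Z': "Z \<in> Lpos C A" "\<And>s. s \<in> S \<Longrightarrow> Z \<subseteq> s" using Z by (auto simp: mubs_def ubs_def revincl_def)
  have "\<exists>D. D \<subseteq> B \<and> s \<in> components (Tset C \<inter> \<Inter>D)" if "s \<in> S" for s
    using LposE[of s C B] that S by (metis subsetD)
  then obtain D where D: "\<And>s. s \<in> S \<Longrightarrow> D s \<subseteq> B \<and> s \<in> components (Tset C \<inter> \<Inter>(D s))" by metis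
  define E where "E = (\<Union>s\<in>S. D s)"
  have sub: "Z \<subseteq> Tset C \<inter> \<Inter>E"
  proof -
    have "Z \<subseteq> H" if "s \<in> S" "H \<in> D s" for s H
      using that Z'(2)[OF that(1)] D[OF that(1)] in_components_subset[of s "Tset C \<inter> \<Inter>(D s)"] by blast
    then show ?thesis using Lpos_subset_Tset[OF Z'(1)] by (auto simp: E_def)
  qed
  obtain W where W: "W \<in> components (Tset C \<inter> \<Inter>E)" "Z \<subseteq> W"
    using exists_component_superset[OF sub _ Lpos_connected[OF Z'(1)]] Lpos_nonempty[OF Z'(1)] sub by blast
  have WB: "W \<in> Lpos C B" using D W(1) by (intro LposI[of E]) (auto simp: E_def)
  have "W \<subseteq> s" if s: "s \<in> S" for s
  proof (rule components_maximal)
    show "s \<in> components (Tset C \<inter> \<Inter>(D s))" using D[OF s] by blast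
    show "connected W" using in_components_connected[OF W(1)] .
    show "W \<subseteq> Tset C \<inter> \<Inter>(D s)" using in_components_subset[OF W(1)] s by (auto simp: E_def)
    show "s \<inter> W \<noteq> {}" using Z'(2)[OF s] W(2) Lpos_nonempty[OF Z'(1)] by blast
  qed
  then have "W \<in> ubs (Lpos C A) revincl S"
    using WB Lpos_mono[OF assms, of C] by (auto simp: ubs_def revincl_def)
  then have "W = Z"
    using Z W(2) by (auto simp: mubs_def revincl_def)
  then show "Z \<in> Lpos C B" using WB by simp
qed

text \<open>A layer in Q has its hyperplanes in Q because Q is an ideal. Conversely, a component of
  an intersection is a minimal upper bound of the hyperplanes involved, so join-closedness
  applies.\<close>

lemma ideal_eq_Lpos:
  assumes A: "arrangement C A" and Q: "order_ideal (Lpos C A) revincl Q" "join_closed (Lpos C A) revincl Q"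
  shows "Q = Lpos C (A \<inter> Q)"
proof (intro set_eqI iffI)
  fix X assume X: "X \<in> Q"
  then have "X \<in> Lpos C A" using Q(1) by (auto simp: order_ideal_def)
  then obtain B where B: "B \<subseteq> A" "X \<in> components (Tset C \<inter> \<Inter>B)" by (rule LposE)
  have "H \<in> Q" if "H \<in> B" for H
  proof -
    have "X \<subseteq> H" "H \<in> Lpos C A"
      using that B in_components_subset hyperplane_in_Lpos[OF A] by blast+
    then show ?thesis using Q(1) X by (auto simp: order_ideal_def revincl_def)
  qed
  then show "X \<in> Lpos C (A \<inter> Q)" using B by (intro LposI[of B]) auto
next
  fix X assume "X \<in> Lpos C (A \<inter> Q)"
  then obtain B where B: "B \<subseteq> A \<inter> Q" "X \<in> components (Tset C \<inter> \<Inter>B)" by (rule LposE)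
  then have "X \<in> mubs (Lpos C A) revincl B" by (intro component_mub) auto
  then show "X \<in> Q" using Q(2) B(1) by (auto simp: join_closed_def)
qed

text \<open>A hyperplane that is a layer of B is contained in a member of B, and comparable layers
  of rank 1 coincide.\<close>

lemma Int_Lpos_subarrangement:
  assumes A: "arrangement C A" and B: "B \<subseteq> A"
  shows "A \<inter> Lpos C B = B"
proof
  have arrB: "arrangement C B" using arrangement_subset[OF A B] .
  interpret A: layer_poset "Lpos C A" revincl "rk C" A "Tset C" using layer_poset_Lpos[OF A] .
  interpret B: layer_poset "Lpos C B" revincl "rk C" B "Tset C" using layer_poset_Lpos[OF arrB] .
  show "B \<subseteq> A \<inter> Lpos C B" using B hyperplane_in_Lpos[OF arrB] by blast
  show "A \<inter> Lpos C B \<subseteq> B"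
  proof
    fix H assume H: "H \<in> A \<inter> Lpos C B"
    then have "Tset C \<noteq> H" using A.rk_A[of H] A.rk_bot by auto
    then obtain b where b: "b \<in> B" "revincl b H"
      using B.atom_separates[OF B.bot_in _ B.bot_le] H by blast
    then have "b = H"
      using A.eq_if_rk_ge[of b H] A.A_in A.rk_A H B by (metis IntD1 in_mono order_refl)
    then show "H \<in> B" using b by simp
  qed
qed

section \<open>From poset ideals to arrangement ideals\<close>

lemma poset_M_ideal_imp_arr_M_ideal:
  assumes A: "arrangement C A" and Q: "M_ideal (Lpos C A) revincl Q" "Q \<noteq> Lpos C A"
    and rank: "poset_rank (Lpos C A) revincl \<le> Suc (poset_rank Q revincl)"
  shows "arr_M_ideal C A (A \<inter> Q)"
proof -
  interpret layer_poset "Lpos C A" revincl "rk C" A "Tset C" using layer_poset_Lpos[OF A] .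
  have ideal: "order_ideal (Lpos C A) revincl Q" "join_closed (Lpos C A) revincl Q" "pure Q revincl"
      "modular_cond (Lpos C A) revincl Q"
    using Q(1) by (auto simp: M_ideal_def)
  have QL: "Lpos C (A \<inter> Q) = Q" using ideal_eq_Lpos[OF A ideal(1,2)] by simp
  have lpQ: "layer_poset Q revincl (rk C) (A \<inter> Q) (Tset C)"
    using layer_poset_Lpos[OF arrangement_subset[OF A], of "A \<inter> Q"] QL by simp
  have "\<exists>H3\<in>A \<inter> Q. K \<subseteq> H3"
    if H: "H1 \<in> A - A \<inter> Q" "H2 \<in> A - A \<inter> Q" "H1 \<noteq> H2" and K: "K \<in> components (H1 \<inter> H2)" for H1 H2 K
  proof -
    have "K \<in> mubs (Lpos C A) revincl {H1, H2}"
      using K components_Int_eq_mubs[OF A_in, of H1 H2] H by blast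
    then show ?thesis
      using M_ideal_imp_atom_below_mub[OF lpQ ideal(1,3,4) rank, of H1 H2 K] H
      by (auto simp: revincl_def)
  qed
  then show ?thesis using ideal(1) Q(2) QL by (auto simp: arr_M_ideal_def)
qed

lemma poset_TM_ideal_imp_connected:
  assumes A: "arrangement C A" and Q: "TM_ideal (Lpos C A) revincl Q"
    and X: "X \<in> Q" and H: "H \<in> A - Q"
  shows "connected (X \<inter> H)"
proof -
  interpret layer_poset "Lpos C A" revincl "rk C" A "Tset C" using layer_poset_Lpos[OF A] .
  have ideal: "order_ideal (Lpos C A) revincl Q"
    using Q by (auto simp: TM_ideal_def)
  have "X \<in> Lpos C A" using X ideal by (auto simp: order_ideal_def)
  have "H \<notin> atoms Q revincl" using H by (auto simp: atoms_def)
  then have "card (mubs (Lpos C A) revincl {H, X}) = 1"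
    using Q X H atoms_eq by (auto simp: TM_ideal_def)
  then have "card (components (X \<inter> H)) = 1"
    using components_Int_eq_mubs[OF \<open>X \<in> Lpos C A\<close>, of H] H by (simp add: insert_commute)
  then show ?thesis
    using components_eq_sing_exists by (metis card_1_singletonE)
qed

lemma TM_ideal_imp_M_ideal: "TM_ideal P le Q \<Longrightarrow> M_ideal P le Q"
  by (auto simp: TM_ideal_def M_ideal_def)

text \<open>If some H did not contain the directions of X in its own, X and H would meet, and the
  layer in X \<inter> H through a common point would be strictly smaller than X. It follows that all
  maximal layers have the same rank.\<close>

lemma directions_maximal:
  assumes A: "arrangement C A" and X: "X \<in> maximals (Lpos C A) revincl"
  shows "directions C X = common_dirs C A"
proof
  have XL: "X \<in> Lpos C A" and Xmax: "\<And>Y. Y \<in> Lpos C A \<Longrightarrow> Y \<subseteq> X \<Longrightarrow> Y = X"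
    using X by (auto simp: maximals_def revincl_def)
  obtain \<theta> where \<theta>: "cover C \<theta> \<in> X" using Lpos_ex_cover[OF XL] ..
  obtain B where B: "B \<subseteq> A" "X = flat C \<theta> (common_dirs C B)" using Lpos_flat[OF A XL \<theta>] by metis
  show "common_dirs C A \<subseteq> directions C X"
    unfolding B(2) directions_flat using B(1) by (intro ann_mono) auto
  have "directions C X \<subseteq> ann {normal_vec C H}" if H: "H \<in> A" for H
  proof (rule ccontr)
    assume n: "\<not> directions C X \<subseteq> ann {normal_vec C H}"
    obtain \<theta>' where \<theta>': "H = flat C \<theta>' (ann {normal_vec C H})" using normal_vec(2)[OF A H] ..
    have "flat C \<theta> (common_dirs C B) \<inter> flat C \<theta>' (ann {normal_vec C H}) \<noteq> {}"
      by (rule flats_intersect) (use n B(2) in simp)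
    then have "X \<inter> H \<noteq> {}" using B(2) \<theta>' by simp
    then obtain \<theta>'' where \<theta>'': "cover C \<theta>'' \<in> X" "cover C \<theta>'' \<in> H"
      using Lpos_subset_Tset[OF XL] unfolding Tset_eq_range_cover by blast
    obtain J where J: "J \<in> Lpos C A" "directions C J = directions C X \<inter> directions C H" "J \<subseteq> X"
      using ex_local_join[OF A XL hyperplane_in_Lpos[OF A H] \<theta>''] by metis
    then have "directions C X \<subseteq> directions C H" using Xmax[of J] by auto
    then show False using n directions_hyperplane[OF A H] by simp
  qed
  then show "directions C X \<subseteq> common_dirs C A" by (auto simp: ann_def)
qed

lemma rk_maximal_Lpos:
  fixes A :: "(complex^'g^'l) set set"
  assumes A: "arrangement C A" and X: "X \<in> maximals (Lpos C A) revincl"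
  shows "rk C X = CARD('l) - dim (common_dirs C A)"
  using directions_maximal[OF A X] by (simp add: rk_def)

lemma pure_Lpos:
  assumes A: "arrangement C A"
  shows "pure (Lpos C A) revincl"
proof -
  interpret layer_poset "Lpos C A" revincl "rk C" A "Tset C" using layer_poset_Lpos[OF A] .
  show ?thesis
    unfolding pure_def using rk_maximal_Lpos[OF A] prk_eq by (auto simp: maximals_def)
qed

lemma poset_rank_Lpos_dim:
  fixes A :: "(complex^'g^'l) set set"
  assumes A: "arrangement C A"
  shows "poset_rank (Lpos C A) revincl = CARD('l) - dim (common_dirs C A)"
proof -
  interpret layer_poset "Lpos C A" revincl "rk C" A "Tset C" using layer_poset_Lpos[OF A] .
  obtain m where "m \<in> maximals (Lpos C A) revincl" using ex_maximal_above[OF bot_in] .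
  then show ?thesis
    using rk_maximal_if_pure[OF pure_Lpos[OF A]] rk_maximal_Lpos[OF A] by metis
qed

section \<open>From arrangement ideals to poset ideals\<close>

lemma layer_poset_ideal_Lpos:
  assumes A: "arrangement C A" and M: "arr_M_ideal C A B"
  shows "layer_poset_ideal (Lpos C A) revincl (rk C) A (Tset C) (Lpos C B)"
proof -
  interpret layer_poset "Lpos C A" revincl "rk C" A "Tset C" using layer_poset_Lpos[OF A] .
  have B: "B \<subseteq> A" using M by (simp add: arr_M_ideal_def)
  have AB: "A \<inter> Lpos C B = B" using Int_Lpos_subarrangement[OF A B] .
  show ?thesis
  proof
    show "order_ideal (Lpos C A) revincl (Lpos C B)" using M by (simp add: arr_M_ideal_def)
    show "join_closed (Lpos C A) revincl (Lpos C B)" using join_closed_Lpos[OF B] .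
    show "Tset C \<in> Lpos C B" using Tset_in_Lpos[OF arrangement_subset[OF A B]] .
    fix H H' K assume *: "H \<in> A - Lpos C B" "H' \<in> A - Lpos C B" "H \<noteq> H'" "K \<in> mubs (Lpos C A) revincl {H, H'}"
    then have "K \<in> components (H \<inter> H')"
      using components_Int_eq_mubs[OF A_in, of H H'] by blast
    moreover have "H \<in> A - B" "H' \<in> A - B" using *(1,2) AB by auto
    ultimately obtain H3 where "H3 \<in> B" "K \<subseteq> H3"
      using M *(3) unfolding arr_M_ideal_def by blast
    then show "\<exists>a\<in>A \<inter> Lpos C B. revincl a K" using AB by (auto simp: revincl_def)
  qed
qed

lemma poset_rank_arr_M_ideal_le:
  assumes A: "arrangement C A" and M: "arr_M_ideal C A B"
  shows "poset_rank (Lpos C A) revincl \<le> Suc (poset_rank (Lpos C B) revincl)"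
proof -
  interpret layer_poset_ideal "Lpos C A" revincl "rk C" A "Tset C" "Lpos C B"
    using layer_poset_ideal_Lpos[OF A M] .
  have B: "B \<subseteq> A" using M by (simp add: arr_M_ideal_def)
  interpret B: layer_poset "Lpos C B" revincl "rk C" B "Tset C"
    using layer_poset_Lpos[OF arrangement_subset[OF A B]] .
  have "rk C X \<le> Suc (poset_rank (Lpos C B) revincl)" if X: "X \<in> Lpos C A" for X
  proof -
    obtain Y where Y: "trace X Y" using ex_trace[OF X] .
    then have "Y \<in> Lpos C B" by (simp add: trace_def)
    then show ?thesis using rk_le_trace[OF X Y] B.rk_le_poset_rank[of Y] by simp
  qed
  then show ?thesis unfolding poset_rank_eq using fin bot_in by (subst Max_le_iff) auto
qed

text \<open>If the character of H depended on those of B, the rank increase would still supply an H'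
  independent of B. A component K of H \<inter> H' lies in some H3 \<in> B and, by rank, has the
  directions common to H and H3. These contain the common kernel of B, yet K lies in H'.\<close>

lemma arr_M_ideal_intersects:
  assumes A: "arrangement C A" and M: "arr_M_ideal C A B"
    and rank: "poset_rank (Lpos C A) revincl = Suc (poset_rank (Lpos C B) revincl)"
    and X: "X \<in> Lpos C B" and H: "H \<in> A - B"
  shows "X \<inter> H \<noteq> {}"
proof -
  interpret layer_poset "Lpos C A" revincl "rk C" A "Tset C" using layer_poset_Lpos[OF A] .
  have BA: "B \<subseteq> A" using M by (simp add: arr_M_ideal_def)
  have arrB: "arrangement C B" using arrangement_subset[OF A BA] .
  have meets: "Y \<inter> K \<noteq> {}" if Y: "Y \<in> Lpos C A" and K: "K \<in> A" and n: "\<not> directions C Y \<subseteq> directions C K" for Y K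
  proof -
    obtain \<theta> where \<theta>: "cover C \<theta> \<in> Y" using Lpos_ex_cover[OF Y] ..
    obtain D where D: "Y = flat C \<theta> (common_dirs C D)" using Lpos_flat[OF A Y \<theta>] by metis
    obtain \<theta>' where \<theta>': "K = flat C \<theta>' (ann {normal_vec C K})" using normal_vec(2)[OF A K] ..
    have "flat C \<theta> (common_dirs C D) \<inter> flat C \<theta>' (ann {normal_vec C K}) \<noteq> {}"
      by (rule flats_intersect) (use n D directions_hyperplane[OF A K] in simp)
    then show ?thesis using D \<theta>' by simp
  qed
  have "\<not> common_dirs C B \<subseteq> directions C H"
  proof
    assume BH: "common_dirs C B \<subseteq> directions C H"
    \<comment> \<open>Otherwise A and B would have the same common kernel, hence the same
      rank.\<close>
    have "\<exists>H'\<in>A. \<not> common_dirs C B \<subseteq> directions C H'"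
    proof (rule ccontr)
      assume "\<not> ?thesis"
      then have "common_dirs C B \<subseteq> common_dirs C A"
        using directions_hyperplane[OF A] by (auto simp: ann_def)
      then have "common_dirs C B = common_dirs C A" using ann_mono[OF image_mono[OF BA]] by blast
      then show False
        using rank poset_rank_Lpos_dim[OF A] poset_rank_Lpos_dim[OF arrB] by simp
    qed
    then obtain H' where H': "H' \<in> A" "\<not> common_dirs C B \<subseteq> directions C H'" by blast
    have "H' \<notin> B"
    proof
      assume "H' \<in> B"
      then have "common_dirs C B \<subseteq> ann {normal_vec C H'}" by (intro ann_mono) auto
      then show False using H'(2) directions_hyperplane[OF A H'(1)] by simp
    qed
    have HA: "H \<in> A" "H \<notin> B" using H by auto
    have "H \<noteq> H'" using BH H'(2) by auto
    \<comment> \<open>Needed because the condition on H1, H2, H3 says nothing about a pair with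
      empty intersection.\<close>
    have "H \<inter> H' \<noteq> {}" using meets[OF A_in[OF HA(1)] H'(1)] BH H'(2) by blast
    then obtain K where K: "K \<in> components (H \<inter> H')" using components_eq_empty by blast
    then obtain H3 where H3: "H3 \<in> B" "K \<subseteq> H3"
      using M H' \<open>H' \<notin> B\<close> HA \<open>H \<noteq> H'\<close> unfolding arr_M_ideal_def by blast
    have H3A: "H3 \<in> A" using H3 BA by blast
    have Kmub: "K \<in> mubs (Lpos C A) revincl {H, H'}"
      using K components_Int_eq_mubs[OF A_in[OF HA(1)] H'(1)] by simp
    then have KL: "K \<in> Lpos C A" "revincl H K" "revincl H3 K" "K \<subseteq> H'"
      using H3 by (auto simp: mubs_def ubs_def revincl_def)
    have nle: "\<not> revincl a H" if "a \<in> A" "a \<noteq> H" for a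
      using eq_if_rk_ge[OF A_in A_in, of a H] that HA rk_A by auto
    have rkK: "rk C K = 2"
      using rk_mub_atom[OF A_in[OF HA(1)] H'(1) nle Kmub] H'(1) \<open>H \<noteq> H'\<close> rk_A[OF HA(1)] by simp
    let ?J = "join (below (Lpos C A) revincl K) revincl H H3"
    note J = join_below[OF KL(1) A_in[OF HA(1)] A_in[OF H3A] KL(2,3)]
    have "H3 \<noteq> H" using H3(1) HA(2) by blast
    then have "rk C ?J = 2"
      using rk_join_atom[OF KL(1) A_in[OF HA(1)] H3A KL(2,3) nle[OF H3A]] rk_A[OF HA(1)] by simp
    then have "?J = K" using eq_if_rk_ge[OF J(1) KL(1) J(4)] rkK by simp
    then have "K \<in> mubs (Lpos C A) revincl {H, H3}"
      using join_below_mub[OF KL(1) A_in[OF HA(1)] A_in[OF H3A] KL(2,3)] by simp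
    then have dK: "directions C K = directions C H \<inter> directions C H3"
      using directions_mub[OF A A_in[OF HA(1)] A_in[OF H3A]] by simp
    have "directions C K \<subseteq> directions C H'"
      using directions_mub[OF A A_in[OF HA(1)] A_in[OF H'(1)] Kmub] by simp
    moreover have "common_dirs C B \<subseteq> directions C H3"
      unfolding directions_hyperplane[OF A H3A] using H3(1) by (intro ann_mono) auto
    ultimately show False using dK BH H'(2) by blast
  qed
  moreover have "common_dirs C B \<subseteq> directions C X"
  proof -
    obtain D where "D \<subseteq> B" "directions C X = common_dirs C D" using Lpos_directions[OF arrB X] by metis
    then show ?thesis using ann_mono[of "normal_vec C ` D" "normal_vec C ` B"] by auto
  qed
  ultimately have "\<not> directions C X \<subseteq> directions C H" by blast
  then show ?thesis
    using meets X Lpos_mono[OF BA] H by blast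
qed

lemma arr_M_ideal_imp_poset_ideal:
  assumes A: "arrangement C A" and M: "arr_M_ideal C A B"
    and rank: "poset_rank (Lpos C A) revincl = Suc (poset_rank (Lpos C B) revincl)"
  shows "M_ideal (Lpos C A) revincl (Lpos C B)"
    "arr_TM_ideal C A B \<Longrightarrow> TM_ideal (Lpos C A) revincl (Lpos C B)"
proof -
  interpret layer_poset_ideal "Lpos C A" revincl "rk C" A "Tset C" "Lpos C B"
    using layer_poset_ideal_Lpos[OF A M] .
  have BA: "B \<subseteq> A" using M by (simp add: arr_M_ideal_def)
  have arrB: "arrangement C B" using arrangement_subset[OF A BA] .
  interpret B: layer_poset "Lpos C B" revincl "rk C" B "Tset C" using layer_poset_Lpos[OF arrB] .
  have mod: "modular_cond (Lpos C A) revincl (Lpos C B)"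
    unfolding modular_cond_def
  proof
    fix x assume x: "x \<in> maximals (Lpos C A) revincl"
    then have xL: "x \<in> Lpos C A" by (simp add: maximals_def)
    obtain y where y: "trace x y" using ex_trace[OF xL] .
    then have y': "y \<in> Lpos C B" "revincl y x" by (auto simp: trace_def)
    \<comment> \<open>The trace of a layer of top rank loses at most one, so it has top rank in L(B)
      and is maximal there.\<close>
    have "rk C y \<ge> poset_rank (Lpos C B) revincl"
      using rk_le_trace[OF xL y] rk_maximal_if_pure[OF pure_Lpos[OF A] x] rank by simp
    then have "z = y" if "z \<in> Lpos C B" "revincl y z" for z
      using B.eq_if_rk_ge[OF y'(1) that] B.rk_le_poset_rank[OF that(1)] by simp
    then have "y \<in> maximals (Lpos C B) revincl" using y'(1) by (auto simp: maximals_def)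
    then show "\<exists>y\<in>maximals (Lpos C B) revincl. revincl y x \<and> modular_elem (below (Lpos C A) revincl x) revincl y"
      using y'(2) trace_modular[OF xL y] by blast
  qed
  have comps: "mubs (Lpos C A) revincl {a, y} = components (y \<inter> a)" "finite (components (y \<inter> a))"
     "components (y \<inter> a) \<noteq> {}"
    if "y \<in> Lpos C B" "a \<in> A - B" for y a
  proof -
    have y: "y \<in> Lpos C A" using that(1) Lpos_mono[OF BA] by blast
    show eq: "mubs (Lpos C A) revincl {a, y} = components (y \<inter> a)"
      using components_Int_eq_mubs[OF y, of a] that(2) by (simp add: insert_commute)
    have "mubs (Lpos C A) revincl {a, y} \<subseteq> Lpos C A" by (auto simp: mubs_def ubs_def)
    \<comment> \<open>Finiteness matters because \<open>card\<close> of an infinite set is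
      0.\<close>
    then show "finite (components (y \<inter> a))" using eq fin finite_subset by metis
    show "components (y \<inter> a) \<noteq> {}"
      using arr_M_ideal_intersects[OF A M rank that] by (simp add: components_eq_empty)
  qed
  have "card (mubs (Lpos C A) revincl {a, y}) \<ge> 1" if "y \<in> Lpos C B" "a \<in> A - B" for y a
    using comps[OF that] by (simp add: Suc_leI card_gt_0_iff)
  then show "M_ideal (Lpos C A) revincl (Lpos C B)"
    using locally_geometric ideal join_closed pure_Lpos[OF arrB] mod
    by (simp add: M_ideal_def atoms_eq B.atoms_eq)
  assume TM: "arr_TM_ideal C A B"
  have "card (mubs (Lpos C A) revincl {a, y}) = 1" if ya: "y \<in> Lpos C B" "a \<in> A - B" for y a
  proof -
    have "connected (y \<inter> a)" using TM ya by (auto simp: arr_TM_ideal_def)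
    then have "components (y \<inter> a) = {y \<inter> a}"
      using comps(3)[OF ya] by (auto simp: components_eq_sing_iff)
    then show ?thesis using comps(1)[OF ya] by simp
  qed
  then show "TM_ideal (Lpos C A) revincl (Lpos C B)"
    using locally_geometric ideal join_closed pure_Lpos[OF arrB] mod
    by (simp add: TM_ideal_def atoms_eq B.atoms_eq)
qed

section \<open>Chains of ideals\<close>

lemma M_ideal_chain_imp_arr_M_ideal_chain:
  assumes A: "arrangement C A"
    and Q0: "Qs 0 = {z. is_min (Lpos C A) revincl z}" and Qr: "Qs r = Lpos C A"
    and Qi: "\<forall>i<r. Qs i \<subset> Qs (Suc i) \<and> M_ideal (Qs (Suc i)) revincl (Qs i)"
    and rank: "\<forall>i\<le>r. poset_rank (Qs i) revincl = i"
  shows "A \<inter> Qs 0 = {}" "A \<inter> Qs r = A" "i \<le> r \<Longrightarrow> Qs i = Lpos C (A \<inter> Qs i)"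
    "i < r \<Longrightarrow> arr_M_ideal C (A \<inter> Qs (Suc i)) (A \<inter> Qs i)"
proof -
  interpret layer_poset "Lpos C A" revincl "rk C" A "Tset C" using layer_poset_Lpos[OF A] .
  have "Tset C \<notin> A" using rk_A[of "Tset C"] rk_bot by auto
  then show "A \<inter> Qs 0 = {}" unfolding Q0 is_min_iff by auto
  show "A \<inter> Qs r = A" unfolding Qr using A_subset by blast
  have arr: "arrangement C (A \<inter> Q)" for Q using arrangement_subset[OF A] by blast
  \<comment> \<open>Downward induction: \<open>Qs n\<close> is an ideal only of
    \<open>Qs (Suc n)\<close>, which must first be recognized as the layer poset of a
    subarrangement.\<close>
  have QL: "Qs i = Lpos C (A \<inter> Qs i)" if "i \<le> r" for i
    using that
  proof (induction i rule: inc_induct)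
    case base
    then show ?case unfolding Qr using A_subset by (simp add: Int_absorb2)
  next
    case (step n)
    have M: "M_ideal (Qs (Suc n)) revincl (Qs n)" and sub: "Qs n \<subset> Qs (Suc n)" using Qi step.hyps by auto
    have "Qs n = Lpos C (A \<inter> Qs (Suc n) \<inter> Qs n)"
      by (rule ideal_eq_Lpos[OF arr]) (use M step.IH in \<open>auto simp: M_ideal_def\<close>)
    moreover have "A \<inter> Qs (Suc n) \<inter> Qs n = A \<inter> Qs n" using sub by blast
    ultimately show ?case by simp
  qed
  then show "i \<le> r \<Longrightarrow> Qs i = Lpos C (A \<inter> Qs i)" .
  assume i: "i < r"
  have eq: "Lpos C (A \<inter> Qs (Suc i)) = Qs (Suc i)" using QL[of "Suc i"] i by simp
  have M: "M_ideal (Qs (Suc i)) revincl (Qs i)" and sub: "Qs i \<subset> Qs (Suc i)" using Qi i by auto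
  have "arr_M_ideal C (A \<inter> Qs (Suc i)) (A \<inter> Qs (Suc i) \<inter> Qs i)"
    by (rule poset_M_ideal_imp_arr_M_ideal[OF arr]) (use M sub rank i eq in auto)
  moreover have "A \<inter> Qs (Suc i) \<inter> Qs i = A \<inter> Qs i" using sub by blast
  ultimately show "arr_M_ideal C (A \<inter> Qs (Suc i)) (A \<inter> Qs i)" by simp
qed

text \<open>Counting steps up from the empty arrangement bounds the rank by i from above; counting
  down from A, whose rank is the length of the chain, bounds it from below.\<close>

lemma arr_M_ideal_chain_rank:
  assumes A: "arrangement C A" "arr_rank C A = r"
    and As: "As 0 = {}" "As r = A" "\<forall>i<r. As i \<subseteq> As (Suc i) \<and> arr_M_ideal C (As (Suc i)) (As i)"
    and i: "i \<le> r"
  shows "arrangement C (As i)" "poset_rank (Lpos C (As i)) revincl = i"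
proof -
  have sub: "As i \<subseteq> A" if "i \<le> r" for i
    using that by (induction i rule: inc_induct) (use As in auto)
  have arr: "arrangement C (As i)" if "i \<le> r" for i using arrangement_subset[OF A(1) sub[OF that]] .
  then show "arrangement C (As i)" using i .
  have step_le: "poset_rank (Lpos C (As (Suc j))) revincl \<le> Suc (poset_rank (Lpos C (As j)) revincl)" if "j < r" for j
    using poset_rank_arr_M_ideal_le[OF arr[of "Suc j"], of "As j"] As(3) that by auto
  have le: "poset_rank (Lpos C (As j)) revincl \<le> j" if "j \<le> r" for j
    using that
  proof (induction j)
    case 0
    show ?case using poset_rank_Lpos_dim[OF arr[of 0]] As(1) by simp
  next
    case (Suc j)
    then show ?case using step_le[of j] by simp
  qed
  have "poset_rank (Lpos C (As j)) revincl \<ge> j" if "j \<le> r" for j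
    using that
  proof (induction j rule: inc_induct)
    case base
    show ?case using poset_rank_Lpos[OF A(1)] A(2) As(2) by simp
  next
    case (step n)
    then show ?case using step_le[of n] by simp
  qed
  then show "poset_rank (Lpos C (As i)) revincl = i" using le i by (simp add: le_antisym)
qed

lemma arr_M_ideal_chain_imp_M_ideal_chain:
  fixes C :: "'g::finite set" and A :: "(complex^'g^'l) set set"
  assumes A: "arrangement C A" "arr_rank C A = r"
    and As: "As 0 = {}" "As r = A" "\<forall>i<r. As i \<subseteq> As (Suc i) \<and> arr_M_ideal C (As (Suc i)) (As i)"
  shows "Lpos C (As 0) = {z. is_min (Lpos C A) revincl z}"
    "i < r \<Longrightarrow> Lpos C (As i) \<subset> Lpos C (As (Suc i))"
    "i < r \<Longrightarrow> M_ideal (Lpos C (As (Suc i))) revincl (Lpos C (As i))"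
    "i < r \<Longrightarrow> arr_TM_ideal C (As (Suc i)) (As i) \<Longrightarrow> TM_ideal (Lpos C (As (Suc i))) revincl (Lpos C (As i))"
proof -
  interpret layer_poset "Lpos C A" revincl "rk C" A "Tset C" using layer_poset_Lpos[OF A(1)] .
  \<comment> \<open>T is a single flat and so has only one component.\<close>
  have "X = Tset C" if "X \<in> Lpos C {}" for X :: "(complex^'g^'l) set"
  proof -
    have "X \<in> components (Tset C \<inter> \<Inter>{})" using LposE[OF that] by (metis subset_empty)
    then show ?thesis
      using components_saturated[OF saturated_arrangement[OF A(1), of "{}"]] by simp
  qed
  moreover have "(Tset C :: (complex^'g^'l) set) \<in> Lpos C {}" using Tset_in_Lpos[OF arrangement_subset[OF A(1)], of "{}"] by simp
  ultimately show "Lpos C (As 0) = {z. is_min (Lpos C A) revincl z}"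
    unfolding As(1) is_min_iff by blast
  assume i: "i < r"
  then have M: "arr_M_ideal C (As (Suc i)) (As i)" "As i \<subseteq> As (Suc i)" using As(3) by auto
  show "Lpos C (As i) \<subset> Lpos C (As (Suc i))"
    using M Lpos_mono[OF M(2), of C] unfolding arr_M_ideal_def by blast
  have arr: "arrangement C (As (Suc i))"
    and rank: "poset_rank (Lpos C (As (Suc i))) revincl = Suc (poset_rank (Lpos C (As i)) revincl)"
    using arr_M_ideal_chain_rank[OF A As, of i] arr_M_ideal_chain_rank[OF A As, of "Suc i"] i by auto
  show "M_ideal (Lpos C (As (Suc i))) revincl (Lpos C (As i))"
    using arr_M_ideal_imp_poset_ideal(1)[OF arr M(1) rank] .
  show "arr_TM_ideal C (As (Suc i)) (As i) \<Longrightarrow> TM_ideal (Lpos C (As (Suc i))) revincl (Lpos C (As i))"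
    using arr_M_ideal_imp_poset_ideal(2)[OF arr M(1) rank] .
qed

theorem theorem5p16:
  fixes C :: "'g::finite set" and A :: "(complex^'g^'l::finite) set set" and r :: nat
  assumes "abelian_arrangement C A"
    and "arr_rank C A = r"
  shows "(supersolvable (Lpos C A) revincl \<longleftrightarrow>
           (\<exists>As :: nat \<Rightarrow> (complex^'g^'l) set set. As 0 = {} \<and> As r = A \<and>
              (\<forall>i<r. As i \<subseteq> As (Suc i) \<and> arr_M_ideal C (As (Suc i)) (As i))))
       \<and> (strictly_supersolvable (Lpos C A) revincl \<longleftrightarrow>
           (\<exists>As :: nat \<Rightarrow> (complex^'g^'l) set set. As 0 = {} \<and> As r = A \<and>
              (\<forall>i<r. As i \<subseteq> As (Suc i) \<and> arr_TM_ideal C (As (Suc i)) (As i))))"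
    (is "(?S \<longleftrightarrow> ?M) \<and> (?S' \<longleftrightarrow> ?M')")
proof -
  have A: "arrangement C A" using abelian_arrangement_imp_arrangement[OF assms(1)] .
  have lg: "locally_geometric (Lpos C A) revincl"
    using layer_poset.locally_geometric[OF layer_poset_Lpos[OF A]] .
  \<comment> \<open>Supersolvability quantifies existentially over the length of the chain; the rank
    of its last member forces it to be r.\<close>
  have rank_r: "n = r" if "Qs n = Lpos C A" "\<forall>i\<le>n. poset_rank (Qs i) revincl = i" for n Qs
    using that poset_rank_Lpos[OF A] assms(2) by (metis order_refl)
  have "?M" if "?S"
  proof -
    obtain n Qs where Q: "Qs 0 = {z. is_min (Lpos C A) revincl z}" "Qs n = Lpos C A"
        "\<forall>i<n. Qs i \<subset> Qs (Suc i) \<and> M_ideal (Qs (Suc i)) revincl (Qs i)"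
        "\<forall>i\<le>n. poset_rank (Qs i) revincl = i"
      using \<open>?S\<close> unfolding supersolvable_def by blast
    have n: "n = r" using rank_r Q(2,4) .
    note ch = M_ideal_chain_imp_arr_M_ideal_chain[OF A Q, unfolded n]
    show ?thesis
      by (rule exI[of _ "\<lambda>i. A \<inter> Qs i"]) (use ch(1,2,4) Q(3) n in auto)
  qed
  moreover have "?S" if "?M"
  proof -
    obtain As where As: "As 0 = {}" "As r = A" "\<forall>i<r. As i \<subseteq> As (Suc i) \<and> arr_M_ideal C (As (Suc i)) (As i)"
      using \<open>?M\<close> by blast
    note ch = arr_M_ideal_chain_imp_M_ideal_chain[OF A assms(2) As]
    show ?thesis
      unfolding supersolvable_def
      by (intro conjI lg exI[of _ r] exI[of _ "\<lambda>i. Lpos C (As i)"])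
         (use ch(1-3) As(2) arr_M_ideal_chain_rank(2)[OF A assms(2) As] in auto)
  qed
  moreover have "?M'" if "?S'"
  proof -
    obtain n Qs where Q: "Qs 0 = {z. is_min (Lpos C A) revincl z}" "Qs n = Lpos C A"
        "\<forall>i<n. Qs i \<subset> Qs (Suc i) \<and> TM_ideal (Qs (Suc i)) revincl (Qs i)"
        "\<forall>i\<le>n. poset_rank (Qs i) revincl = i"
      using \<open>?S'\<close> unfolding strictly_supersolvable_def by blast
    have n: "n = r" using rank_r Q(2,4) .
    \<comment> \<open>The chain lemma for M-ideals also covers the strict case; only connectedness
      of the intersections remains.\<close>
    have QM: "\<forall>i<n. Qs i \<subset> Qs (Suc i) \<and> M_ideal (Qs (Suc i)) revincl (Qs i)"
      using Q(3) TM_ideal_imp_M_ideal by blast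
    note ch = M_ideal_chain_imp_arr_M_ideal_chain[OF A Q(1,2) QM Q(4), unfolded n]
    have "arr_TM_ideal C (A \<inter> Qs (Suc i)) (A \<inter> Qs i)" if i: "i < r" for i
    proof -
      have arr: "arrangement C (A \<inter> Qs (Suc i))" using arrangement_subset[OF A] by blast
      have eq: "Lpos C (A \<inter> Qs (Suc i)) = Qs (Suc i)" "Lpos C (A \<inter> Qs i) = Qs i"
        using ch(3)[of "Suc i"] ch(3)[of i] i by auto
      have TM: "TM_ideal (Lpos C (A \<inter> Qs (Suc i))) revincl (Qs i)" using Q(3) i n eq by simp
      have "connected (X \<inter> H)"
        if "X \<in> Lpos C (A \<inter> Qs i)" "H \<in> A \<inter> Qs (Suc i) - A \<inter> Qs i" for X H
        by (rule poset_TM_ideal_imp_connected[OF arr TM]) (use that eq in auto)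
      then show ?thesis using ch(4)[OF i] by (auto simp: arr_TM_ideal_def)
    qed
    then show ?thesis
      by (intro exI[of _ "\<lambda>i. A \<inter> Qs i"]) (use ch(1,2) Q(3) n in auto)
  qed
  moreover have "?S'" if "?M'"
  proof -
    obtain As where As: "As 0 = {}" "As r = A" "\<forall>i<r. As i \<subseteq> As (Suc i) \<and> arr_TM_ideal C (As (Suc i)) (As i)"
      using \<open>?M'\<close> by blast
    then have As': "\<forall>i<r. As i \<subseteq> As (Suc i) \<and> arr_M_ideal C (As (Suc i)) (As i)"
      by (simp add: arr_TM_ideal_def)
    note ch = arr_M_ideal_chain_imp_M_ideal_chain[OF A assms(2) As(1,2) As']
    show ?thesis
      unfolding strictly_supersolvable_def
      by (intro conjI lg exI[of _ r] exI[of _ "\<lambda>i. Lpos C (As i)"])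
         (use ch(1,2,4) As(2,3) arr_M_ideal_chain_rank(2)[OF A assms(2) As(1,2) As'] in auto)
  qed
  ultimately show ?thesis by blast
qed

end
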